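(* Let $(K,\theta)\models\mathrm{ACFH}$. Let $Y\subseteq K^n$ be a multiplicatively $n$-free constructible set, let $P_1,\dots,P_n\in\mathbb Z[X]\setminus\mathbb Z$ and let $\delta_1,\dots,\delta_n\in K^\times$. Then there exists $(a_1,\dots,a_n)\in Y$ such that $P_1(\theta)(a_1)=\delta_1,\dots,P_n(\theta)(a_n)=\delta_n$.
   Context: $\mathcal L$ is the language of rings with a unary function symbol $\theta$; $T$ is the $\mathcal L$-theory of algebraically closed fields with $\theta$ multiplicative ($\theta(xy)=\theta(x)\theta(y)$, $\theta(1)=1$, $\theta(x)=0$ iff $x=0$); $\mathrm{ACFH}$ is its model companion, namely $T$ together with the first-order axioms: for every complete system of minimal equations $\tau(x;y)$ over $K$ with $|x|=r,|y|=t$ and every multiplicatively $r$-free affine variety $V\subseteq K^{2r+2t}$ contained in $\tau(K)\times\tau^\theta(K)$, there are $a\in K^r,b\in K^t$ with $(a,b,\theta(a),\theta(b))\in V$ (complete system of minimal equations over $K$ in $x=(x_1,\dots,x_r)$, $y=(y_1,\dots,y_t)$: for given $n_i\ge1$ and each $(k_1,\dots,k_t)$ with $0\le k_i\le n_i$, $\gcd(k_i)=1$, an equation $(y_1^{k_1}\cdots y_t^{k_t})^N=c\,x_1^{l_1}\cdots x_r^{l_r}$ with $\gcd(N,l_1,\dots,l_r)=1$, $c\in K^\times$, $N=n_i$ for the $i$-th unit vector; $\tau^\theta$ replaces each $c$ by $\theta(c)$). An affine variety $V\subseteq K^{r+m}$ is multiplicatively $r$-free if for a generic point $(a_1,\dots,a_{r+m})$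 of $V$ over $K$, $a_1^{l_1}\cdots a_r^{l_r}\in K^\times$ with $l_i\in\mathbb Z$ forces all $l_i=0$; a constructible set is multiplicatively $r$-free if some irreducible component of its Zariski closure is. For $P(X)=\sum_{i=0}^d k_iX^i\in\mathbb Z[X]$, $P(\theta)$ is the endomorphism of $K^\times$ given by $x\mapsto x^{k_0}\theta(x^{k_1})\theta^{(2)}(x^{k_2})\cdots\theta^{(d)}(x^{k_d})$, where $\theta^{(i)}$ is the $i$-th iterate of $\theta$. *)

theory Defs
  imports
    "HOL-Library.Poly_Mapping"
    "HOL-Computational_Algebra.Computational_Algebra"
    "HOL-Algebra.Algebraic_Closure_Type"
begin

text \<open>The points of $K^n$ are the lists of length $n$ over the type \<open>'k\<close> of elements of $K$;
  coordinates and variables are numbered from 0.\<close>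

definition affine_space :: "nat \<Rightarrow> 'k list set" where
  "affine_space n = {a. length a = n}"


subsection \<open>Polynomials and the Zariski topology\<close>

type_synonym 'k mpoly = "(nat \<Rightarrow>\<^sub>0 nat) \<Rightarrow>\<^sub>0 'k"

definition mpoly_ring :: "nat \<Rightarrow> ('k::zero) mpoly set" where
  "mpoly_ring n = {p. \<forall>m \<in> Poly_Mapping.keys p. Poly_Mapping.keys m \<subseteq> {..<n}}"

text \<open>The homomorphism \<open>h\<close> is applied to the coefficients, so that a polynomial over $K$ can be
  evaluated at a point with coordinates in an extension of $K$.\<close>

definition mpoly_eval :: "('k::zero \<Rightarrow> 'l::comm_ring_1) \<Rightarrow> 'k mpoly \<Rightarrow> 'l list \<Rightarrow> 'l" where
  "mpoly_eval h p a =
     (\<Sum>m \<in> Poly_Mapping.keys p.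
        h (Poly_Mapping.lookup p m) * (\<Prod>i \<in> Poly_Mapping.keys m. (a ! i) ^ Poly_Mapping.lookup m i))"

definition zariski_closed :: "nat \<Rightarrow> ('k::field) list set \<Rightarrow> bool" where
  "zariski_closed n V \<longleftrightarrow>
     (\<exists>S \<subseteq> mpoly_ring n. V = {a \<in> affine_space n. \<forall>p\<in>S. mpoly_eval (\<lambda>c. c) p a = 0})"

definition zariski_closure :: "nat \<Rightarrow> ('k::field) list set \<Rightarrow> 'k list set" where
  "zariski_closure n Y = \<Inter>{V. zariski_closed n V \<and> Y \<subseteq> V}"

text \<open>Affine varieties are irreducible (they have a generic point).\<close>

definition affine_variety :: "nat \<Rightarrow> ('k::field) list set \<Rightarrow> bool" where
  "affine_variety n V \<longleftrightarrow> zariski_closed n V \<and> V \<noteq> {} \<and>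
     (\<forall>A B. zariski_closed n A \<and> zariski_closed n B \<and> V \<subseteq> A \<union> B \<longrightarrow> V \<subseteq> A \<or> V \<subseteq> B)"

definition irreducible_component :: "nat \<Rightarrow> ('k::field) list set \<Rightarrow> 'k list set \<Rightarrow> bool" where
  "irreducible_component n V Z \<longleftrightarrow> affine_variety n V \<and> V \<subseteq> Z \<and>
     (\<forall>W. affine_variety n W \<and> V \<subseteq> W \<and> W \<subseteq> Z \<longrightarrow> W = V)"

inductive constructible :: "nat \<Rightarrow> ('k::field) list set \<Rightarrow> bool" for n where
  closed: "zariski_closed n V \<Longrightarrow> constructible n V"
| compl: "constructible n Y \<Longrightarrow> constructible n (affine_space n - Y)"
| union: "constructible n Y \<Longrightarrow> constructible n Z \<Longrightarrow> constructible n (Y \<union> Z)"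


subsection \<open>Generic points and multiplicative freeness\<close>

text \<open>Generic points over $K$ live in a universal domain: the algebraic closure of the field of
  rational functions over $K$ in countably many variables. Every finitely generated field extension
  of $K$ embeds into it over $K$, so each affine variety has a generic point there; any two
  generic points of $V$ generate $K$-isomorphic extensions.\<close>

type_synonym 'k univ_dom = "'k mpoly fract alg_closure"

definition univ_emb :: "'k::field \<Rightarrow> 'k univ_dom" where
  "univ_emb c = to_ac (Fract (Poly_Mapping.single 0 c) 1)"

lemma univ_emb_hom:
  "univ_emb 0 = 0" "univ_emb 1 = 1"
  "univ_emb (c + d) = univ_emb c + univ_emb d"
  "univ_emb (c * d) = univ_emb c * univ_emb d"
  by (simp_all add: univ_emb_def Poly_Mapping.single_add Poly_Mapping.mult_single
      flip: Zero_fract_def One_fract_def to_ac_add to_ac_mult)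

definition generic_point :: "nat \<Rightarrow> ('k::field) list set \<Rightarrow> 'k univ_dom list \<Rightarrow> bool" where
  "generic_point n V a \<longleftrightarrow> a \<in> affine_space n \<and>
     (\<forall>p \<in> mpoly_ring n. mpoly_eval univ_emb p a = 0 \<longleftrightarrow> (\<forall>v\<in>V. mpoly_eval (\<lambda>c. c) p v = 0))"

text \<open>Freeness concerns elements of a multiplicative group, so the first \<open>r\<close> coordinates of the
  generic point have to be nonzero; \<open>0 powi l = 0\<close> for \<open>l \<noteq> 0\<close> would make e.g. a variety on which
  the first coordinate vanishes identically free for the wrong reason.\<close>

definition mult_free :: "nat \<Rightarrow> nat \<Rightarrow> ('k::field) list set \<Rightarrow> bool" where
  "mult_free n r V \<longleftrightarrow>
     (\<exists>a. generic_point n V a \<and> (\<forall>i<r. a ! i \<noteq> 0) \<and>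
        (\<forall>l :: nat \<Rightarrow> int. (\<Prod>i<r. (a ! i) powi l i) \<in> univ_emb ` (- {0}) \<longrightarrow> (\<forall>i<r. l i = 0)))"

definition mult_free_constructible :: "nat \<Rightarrow> nat \<Rightarrow> ('k::field) list set \<Rightarrow> bool" where
  "mult_free_constructible n r Y \<longleftrightarrow> constructible n Y \<and>
     (\<exists>V. irreducible_component n V (zariski_closure n Y) \<and> mult_free n r V)"


subsection \<open>Complete systems of minimal equations\<close>

text \<open>\<open>Min_Eq N c l\<close> stands for the equation
  $(y_1^{k_1}\cdots y_t^{k_t})^N = c\, x_1^{l_1}\cdots x_r^{l_r}$ attached to an exponent vector \<open>k\<close>.\<close>

datatype 'k min_eq = Min_Eq (min_exp: nat) (min_const: 'k) (min_pow: "int list")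

definition sys_index :: "nat list \<Rightarrow> nat list set" where
  "sys_index n = {k. length k = length n \<and> (\<forall>i<length n. k ! i \<le> n ! i) \<and> Gcd (set k) = 1}"

definition complete_system :: "nat \<Rightarrow> nat list \<Rightarrow> (nat list \<Rightarrow> ('k::field) min_eq) \<Rightarrow> bool" where
  "complete_system r n \<tau> \<longleftrightarrow>
     (\<forall>i<length n. n ! i \<ge> 1) \<and>
     (\<forall>k \<in> sys_index n.
        min_exp (\<tau> k) \<ge> 1 \<and> min_const (\<tau> k) \<noteq> 0 \<and> length (min_pow (\<tau> k)) = r \<and>
        Gcd (insert (int (min_exp (\<tau> k))) (set (min_pow (\<tau> k)))) = 1) \<and>
     (\<forall>i<length n. min_exp (\<tau> ((replicate (length n) 0)[i := 1])) = n ! i)"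

text \<open>The equations have integer exponents and are read in the multiplicative group: solutions have
  nonzero coordinates. (With zeros allowed, the axiom scheme below would be inconsistent: for
  $r = 2$, $t = 0$ and $V$ given by $x_1(x_2-1)=1$, $x'_1=x'_2=0$ it would ask for
  $a_1 \neq 0$ with $\theta(a_1)=0$.)\<close>

definition sys_solutions ::
  "nat \<Rightarrow> nat list \<Rightarrow> (nat list \<Rightarrow> ('k::field) min_eq) \<Rightarrow> 'k list set" where
  "sys_solutions r n \<tau> =
     {x @ y | x y. x \<in> affine_space r \<and> y \<in> affine_space (length n) \<and>
        0 \<notin> set x \<and> 0 \<notin> set y \<and>
        (\<forall>k \<in> sys_index n.
           (\<Prod>i<length n. (y ! i) ^ (k ! i)) ^ min_exp (\<tau> k) =
           min_const (\<tau> k) * (\<Prod>i<r. (x ! i) powi (min_pow (\<tau> k) ! i)))}"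

definition sys_twist :: "('k \<Rightarrow> 'k) \<Rightarrow> (nat list \<Rightarrow> 'k min_eq) \<Rightarrow> nat list \<Rightarrow> 'k min_eq" where
  "sys_twist \<theta> \<tau> k = Min_Eq (min_exp (\<tau> k)) (\<theta> (min_const (\<tau> k))) (min_pow (\<tau> k))"


subsection \<open>The theory ACFH\<close>

definition multiplicative_map :: "('k::field \<Rightarrow> 'k) \<Rightarrow> bool" where
  "multiplicative_map \<theta> \<longleftrightarrow>
     (\<forall>x y. \<theta> (x * y) = \<theta> x * \<theta> y) \<and> \<theta> 1 = 1 \<and> (\<forall>x. \<theta> x = 0 \<longleftrightarrow> x = 0)"

text \<open>\<open>ACFH \<theta>\<close> says that the field \<open>'k\<close>, algebraically closed by its type class, together with
  \<open>\<theta>\<close> is a model of ACFH.\<close>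

definition ACFH :: "('k::alg_closed_field \<Rightarrow> 'k) \<Rightarrow> bool" where
  "ACFH \<theta> \<longleftrightarrow> multiplicative_map \<theta> \<and>
     (\<forall>r t n \<tau> V.
        length n = t \<and> complete_system r n \<tau> \<and>
        affine_variety (2 * r + 2 * t) V \<and> mult_free (2 * r + 2 * t) r V \<and>
        V \<subseteq> {u @ v | u v. u \<in> sys_solutions r n \<tau> \<and> v \<in> sys_solutions r n (sys_twist \<theta> \<tau>)} \<longrightarrow>
        (\<exists>a \<in> affine_space r. \<exists>b \<in> affine_space t. a @ b @ map \<theta> a @ map \<theta> b \<in> V))"

definition poly_endo :: "('k::field \<Rightarrow> 'k) \<Rightarrow> int poly \<Rightarrow> 'k \<Rightarrow> 'k" where
  "poly_endo \<theta> P x = (\<Prod>i\<le>degree P. (\<theta> ^^ i) (x powi coeff P i))"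

end

theory Submission
  imports Defs
begin

text \<open>Let \<open>a\<close> be a generic point of the free component of the closure of \<open>Y\<close>; it suffices to find a
  specialisation of \<open>a\<close> at which a certain polynomial \<open>f\<close> with \<open>f a \<noteq> 0\<close> does not vanish. Introduce
  coordinates $x_{i,j}$ standing for $\theta^{(j)}(a_i)$, $j < \deg P_i$, with $x_{i,0} = a_i$ and the others
  multiplicatively independent over $K$ and \<open>a\<close>. The values of $\theta$ on them are prescribed by
  $x'_{i,j} = x_{i,j+1}$, except for the last one, which is a root of $P_i(\theta)(a_i) = \delta_i$. By the
  Nullstellensatz this tuple is a generic point of its locus over $K$, and the axioms of ACFH provide a
  point of the locus on the graph of $\theta$. To keep \<open>f\<close> from vanishing, \<open>f a\<close> is made a further coordinate,
  unless it is multiplicatively dependent on \<open>a\<close>; in that case \<open>f\<close> has no zeros on the torus.\<close>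

text \<open>The axioms demand freeness only of the coordinates in the place of \<open>a\<close>,
  never of those in the place of \<open>\<theta>(a)\<close>. All constraints therefore go to the
  \<open>x'\<close> side: the shift relations, and \<open>P_i(\<theta>)(a_i) = \<delta>_i\<close>,
  which is solved for the top iterate. Here nonconstancy of \<open>P_i\<close> enters: in degree 0
  the equation would fall on \<open>a_i\<close> itself. The root exists because the universal domain
  is algebraically closed. The variety is never described by equations: the locus of one tuple is
  automatically irreducible. The axioms return a point of a closed set, while \<open>Y\<close>
  contains only the part \<open>f \<noteq> 0\<close> of its component; what is known to stay nonzero
  under specialisation is a coordinate, whence the detour through \<open>f(a)\<close>. If
  \<open>f(a)\<close> depends on \<open>a\<close>, some power of it with positive exponent is a
  constant times a Laurent monomial in \<open>a\<close>, and this identity survives specialisation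
  to nonzero coordinates.\<close>

definition subring_set :: "'a::comm_ring_1 set \<Rightarrow> bool" where
  "subring_set A \<longleftrightarrow> 0 \<in> A \<and> 1 \<in> A \<and> (\<forall>x\<in>A. - x \<in> A) \<and> (\<forall>x\<in>A. \<forall>y\<in>A. x + y \<in> A \<and> x * y \<in> A)"

text \<open>Domains are subsets because the specialisation argument climbs a chain K, K[a_1],
  K[a_1,a_2], ... inside one fixed field.\<close>

definition hom_on :: "'a::comm_ring_1 set \<Rightarrow> ('a \<Rightarrow> 'b::comm_ring_1) \<Rightarrow> bool" where
  "hom_on A h \<longleftrightarrow> h 0 = 0 \<and> h 1 = 1 \<and>
     (\<forall>x\<in>A. \<forall>y\<in>A. h (x + y) = h x + h y \<and> h (x * y) = h x * h y)"

lemma subring_setD: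
  assumes "subring_set A"
  shows "0 \<in> A" "1 \<in> A" "x \<in> A \<Longrightarrow> - x \<in> A"
    "x \<in> A \<Longrightarrow> y \<in> A \<Longrightarrow> x + y \<in> A" "x \<in> A \<Longrightarrow> y \<in> A \<Longrightarrow> x * y \<in> A"
  using assms by (auto simp: subring_set_def)

lemma subring_set_UNIV: "subring_set UNIV"
  by (simp add: subring_set_def)

lemma subring_set_power: "subring_set A \<Longrightarrow> x \<in> A \<Longrightarrow> x ^ n \<in> A"
  by (induction n) (auto simp: subring_setD)

lemma subring_set_sum: "subring_set A \<Longrightarrow> (\<And>i. i \<in> I \<Longrightarrow> f i \<in> A) \<Longrightarrow> sum f I \<in> A"
  by (induction I rule: infinite_finite_induct) (auto simp: subring_setD)

lemma subring_set_prod: "subring_set A \<Longrightarrow> (\<And>i. i \<in> I \<Longrightarrow> f i \<in> A) \<Longrightarrow> prod f I \<in> A"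
  by (induction I rule: infinite_finite_induct) (auto simp: subring_setD)

lemma hom_onD:
  assumes "hom_on A h"
  shows "h 0 = 0" "h 1 = 1" "x \<in> A \<Longrightarrow> y \<in> A \<Longrightarrow> h (x + y) = h x + h y"
    "x \<in> A \<Longrightarrow> y \<in> A \<Longrightarrow> h (x * y) = h x * h y"
  using assms by (auto simp: hom_on_def)

lemma hom_on_uminus:
  assumes "subring_set A" "hom_on A h" "x \<in> A"
  shows "h (- x) = - h x"
  using hom_onD(3)[OF assms(2,3), of "- x"] assms
  by (simp add: subring_setD hom_onD(1)[OF assms(2)] eq_neg_iff_add_eq_0 add.commute)

lemma hom_on_power:
  assumes "subring_set A" "hom_on A h" "x \<in> A"
  shows "h (x ^ n) = h x ^ n"
  by (induction n)
    (simp_all add: hom_onD(2)[OF assms(2)] hom_onD(4)[OF assms(2)] assms subring_set_power)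

lemma hom_on_sum:
  assumes "subring_set A" "hom_on A h" "\<And>i. i \<in> I \<Longrightarrow> f i \<in> A"
  shows "h (sum f I) = (\<Sum>i\<in>I. h (f i))"
  using assms(3)
  by (induction I rule: infinite_finite_induct)
    (simp_all add: hom_onD(1)[OF assms(2)] hom_onD(3)[OF assms(2)] assms subring_set_sum)

lemma hom_on_prod:
  assumes "subring_set A" "hom_on A h" "\<And>i. i \<in> I \<Longrightarrow> f i \<in> A"
  shows "h (prod f I) = (\<Prod>i\<in>I. h (f i))"
  using assms(3)
  by (induction I rule: infinite_finite_induct)
    (simp_all add: hom_onD(2)[OF assms(2)] hom_onD(4)[OF assms(2)] assms subring_set_prod)

lemma hom_on_id: "hom_on UNIV (\<lambda>c. c)"
  by (simp add: hom_on_def)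

lemma hom_on_univ_emb: "hom_on UNIV univ_emb"
  by (simp add: hom_on_def univ_emb_hom)

lemma field_hom_eq_0_iff:
  fixes h :: "'a::field \<Rightarrow> 'b::field"
  assumes "hom_on UNIV h"
  shows "h x = 0 \<longleftrightarrow> x = 0"
proof (cases "x = 0")
  case False
  have "h x * h (inverse x) = 1"
    using hom_onD(4)[OF assms, of x "inverse x"] hom_onD(2)[OF assms] False by simp
  with False show ?thesis by auto
qed (simp add: hom_onD(1)[OF assms])

lemma field_hom_inj:
  fixes h :: "'a::field \<Rightarrow> 'b::field"
  assumes "hom_on UNIV h"
  shows "inj h"
proof (rule injI)
  fix x y assume "h x = h y"
  then have "h (x + - y) = 0"
    using hom_onD(3)[OF assms, of x "- y"] hom_on_uminus[OF subring_set_UNIV assms] by simp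
  then show "x = y" by (simp add: field_hom_eq_0_iff[OF assms])
qed


section \<open>Evaluation of polynomials and closed sets\<close>

definition monom_eval :: "(nat \<Rightarrow>\<^sub>0 nat) \<Rightarrow> 'l::comm_ring_1 list \<Rightarrow> 'l" where
  "monom_eval m a = (\<Prod>i \<in> Poly_Mapping.keys m. (a ! i) ^ Poly_Mapping.lookup m i)"

lemma monom_eval_superset:
  assumes "finite S" "Poly_Mapping.keys m \<subseteq> S"
  shows "monom_eval m a = (\<Prod>i\<in>S. (a ! i) ^ Poly_Mapping.lookup m i)"
  unfolding monom_eval_def using assms
  by (intro prod.mono_neutral_left) (auto simp: in_keys_iff)

lemma monom_eval_0: "monom_eval 0 a = 1"
  by (simp add: monom_eval_def)

lemma monom_eval_add: "monom_eval (m + m') a = monom_eval m a * monom_eval m' a"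
proof -
  let ?S = "Poly_Mapping.keys m \<union> Poly_Mapping.keys m'"
  show ?thesis
    using Poly_Mapping.keys_add[of m m']
    by (simp add: monom_eval_superset[of ?S] lookup_add power_add prod.distrib)
qed

lemma mpoly_eval_superset:
  assumes "h 0 = 0" "finite S" "Poly_Mapping.keys p \<subseteq> S"
  shows "mpoly_eval h p a = (\<Sum>m\<in>S. h (Poly_Mapping.lookup p m) * monom_eval m a)"
  unfolding mpoly_eval_def monom_eval_def[symmetric] using assms
  by (intro sum.mono_neutral_left) (auto simp: in_keys_iff)

lemma mpoly_eval_0: "mpoly_eval h 0 a = 0"
  by (simp add: mpoly_eval_def)

lemma mpoly_eval_single:
  "h 0 = 0 \<Longrightarrow> mpoly_eval h (Poly_Mapping.single m c) a = h c * monom_eval m a"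
  by (subst mpoly_eval_superset[of h "{m}"]) (auto simp: lookup_single)

lemma mpoly_eval_add:
  fixes h :: "'k::comm_ring_1 \<Rightarrow> 'l::comm_ring_1"
  assumes "hom_on UNIV h"
  shows "mpoly_eval h (p + q) a = mpoly_eval h p a + mpoly_eval h q a"
proof -
  let ?S = "Poly_Mapping.keys p \<union> Poly_Mapping.keys q"
  show ?thesis
    using Poly_Mapping.keys_add[of p q]
    by (simp add: mpoly_eval_superset[of h ?S, OF hom_onD(1)[OF assms]] lookup_add
        hom_onD(3)[OF assms] distrib_right sum.distrib)
qed

lemma mpoly_eval_sum:
  fixes h :: "'k::comm_ring_1 \<Rightarrow> 'l::comm_ring_1"
  assumes "hom_on UNIV h"
  shows "mpoly_eval h (sum f I) a = (\<Sum>i\<in>I. mpoly_eval h (f i) a)"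
  by (induction I rule: infinite_finite_induct) (simp_all add: mpoly_eval_0 mpoly_eval_add[OF assms])

lemma mpoly_eq_sum_singles:
  "p = (\<Sum>m\<in>Poly_Mapping.keys p. Poly_Mapping.single m (Poly_Mapping.lookup p m))"
  by (rule poly_mapping_eqI) (auto simp: lookup_sum lookup_single when_def in_keys_iff)

lemma mpoly_eval_mult:
  fixes h :: "'k::comm_ring_1 \<Rightarrow> 'l::comm_ring_1"
  assumes "hom_on UNIV h"
  shows "mpoly_eval h (p * q) a = mpoly_eval h p a * mpoly_eval h q a"
proof -
  let ?s = "\<lambda>p m. Poly_Mapping.single m (Poly_Mapping.lookup p m)"
  note h0 = hom_onD(1)[OF assms]
  have "p * q = (\<Sum>m\<in>Poly_Mapping.keys p. \<Sum>m'\<in>Poly_Mapping.keys q. ?s p m * ?s q m')"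
    unfolding sum_product[symmetric] by (simp flip: mpoly_eq_sum_singles)
  then have "mpoly_eval h (p * q) a =
      (\<Sum>m\<in>Poly_Mapping.keys p. \<Sum>m'\<in>Poly_Mapping.keys q.
         (h (Poly_Mapping.lookup p m) * monom_eval m a) * (h (Poly_Mapping.lookup q m') * monom_eval m' a))"
    by (simp add: mpoly_eval_sum[OF assms] mult_single mpoly_eval_single[of h, OF h0] monom_eval_add
        hom_onD(4)[OF assms] mult_ac)
  also have "\<dots> = mpoly_eval h p a * mpoly_eval h q a"
    by (simp add: mpoly_eval_def monom_eval_def sum_product)
  finally show ?thesis .
qed

lemma mpoly_eval_1:
  fixes h :: "'k::comm_ring_1 \<Rightarrow> 'l::comm_ring_1"
  assumes "hom_on UNIV h"
  shows "mpoly_eval h 1 a = 1"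
  using mpoly_eval_single[of h 0 1 a] by (simp add: hom_onD(1,2)[OF assms] monom_eval_0)

lemma mpoly_eval_uminus:
  fixes h :: "'k::comm_ring_1 \<Rightarrow> 'l::comm_ring_1"
  assumes "hom_on UNIV h"
  shows "mpoly_eval h (- p) a = - mpoly_eval h p a"
  using mpoly_eval_add[OF assms, of p "- p" a] by (simp add: mpoly_eval_0 eq_neg_iff_add_eq_0 add.commute)

lemma mpoly_eval_diff:
  fixes h :: "'k::comm_ring_1 \<Rightarrow> 'l::comm_ring_1"
  assumes "hom_on UNIV h"
  shows "mpoly_eval h (p - q) a = mpoly_eval h p a - mpoly_eval h q a"
  using mpoly_eval_add[OF assms, of p "- q" a] by (simp add: mpoly_eval_uminus[OF assms])

lemma mpoly_eval_power:
  fixes h :: "'k::comm_ring_1 \<Rightarrow> 'l::comm_ring_1"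
  assumes "hom_on UNIV h"
  shows "mpoly_eval h (p ^ n) a = mpoly_eval h p a ^ n"
  by (induction n) (simp_all add: mpoly_eval_1[OF assms] mpoly_eval_mult[OF assms])

lemma mpoly_eval_cong:
  assumes "p \<in> mpoly_ring n" "\<And>i. i < n \<Longrightarrow> a ! i = b ! i"
  shows "mpoly_eval h p a = mpoly_eval h p b"
proof -
  have "a ! i = b ! i" if "m \<in> Poly_Mapping.keys p" "i \<in> Poly_Mapping.keys m" for m i
    using assms that by (force simp: mpoly_ring_def)
  then show ?thesis by (simp add: mpoly_eval_def cong: sum.cong prod.cong)
qed

lemma mpoly_ring_single: "Poly_Mapping.keys m \<subseteq> {..<n} \<Longrightarrow> Poly_Mapping.single m c \<in> mpoly_ring n"
  by (auto simp: mpoly_ring_def split: if_splits)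

lemma mpoly_ring_add: "p \<in> mpoly_ring n \<Longrightarrow> q \<in> mpoly_ring n \<Longrightarrow> p + q \<in> mpoly_ring n"
  using Poly_Mapping.keys_add[of p q] by (fastforce simp: mpoly_ring_def)

lemma mpoly_ring_uminus:
  fixes p :: "'k::comm_ring_1 mpoly"
  shows "p \<in> mpoly_ring n \<Longrightarrow> - p \<in> mpoly_ring n"
  by (simp add: mpoly_ring_def in_keys_iff)

lemma mpoly_ring_mult:
  assumes "p \<in> mpoly_ring n" "q \<in> mpoly_ring n"
  shows "p * q \<in> mpoly_ring n"
proof -
  have "Poly_Mapping.keys m \<subseteq> {..<n}" if m: "m \<in> Poly_Mapping.keys (p * q)" for m
  proof -
    from m obtain m1 m2 where m12: "m = m1 + m2" "m1 \<in> Poly_Mapping.keys p" "m2 \<in> Poly_Mapping.keys q"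
      using Poly_Mapping.keys_mult[of p q] by auto
    then have "Poly_Mapping.keys m1 \<union> Poly_Mapping.keys m2 \<subseteq> {..<n}"
      using assms by (auto simp: mpoly_ring_def)
    then show ?thesis using Poly_Mapping.keys_add[of m1 m2] m12(1) by blast
  qed
  then show ?thesis by (auto simp: mpoly_ring_def)
qed

lemma subring_set_mpoly_ring: "subring_set (mpoly_ring n :: 'k::comm_ring_1 mpoly set)"
proof -
  have "(1::'k mpoly) \<in> mpoly_ring n" by (simp add: mpoly_ring_def)
  then show ?thesis
    by (auto simp: subring_set_def mpoly_ring_add mpoly_ring_mult mpoly_ring_uminus)
      (simp add: mpoly_ring_def)
qed

lemma mpoly_ring_diff:
  fixes p :: "'k::comm_ring_1 mpoly"
  shows "p \<in> mpoly_ring n \<Longrightarrow> q \<in> mpoly_ring n \<Longrightarrow> p - q \<in> mpoly_ring n"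
  using mpoly_ring_add[of p n "- q"] mpoly_ring_uminus[of q n] by simp

lemma mpoly_ring_mono: "p \<in> mpoly_ring n \<Longrightarrow> n \<le> m \<Longrightarrow> p \<in> mpoly_ring m"
  by (fastforce simp: mpoly_ring_def)

section \<open>Vanishing ideals, closed sets and irreducibility\<close>

abbreviation mpoly_value :: "'k::field mpoly \<Rightarrow> 'k list \<Rightarrow> 'k" where
  "mpoly_value \<equiv> mpoly_eval (\<lambda>c. c)"

definition vanishing_ideal :: "nat \<Rightarrow> 'k::field list set \<Rightarrow> 'k mpoly set" where
  "vanishing_ideal n V = {p \<in> mpoly_ring n. \<forall>v\<in>V. mpoly_value p v = 0}"

definition zero_set :: "nat \<Rightarrow> 'k::field mpoly set \<Rightarrow> 'k list set" where
  "zero_set n S = {a \<in> affine_space n. \<forall>p\<in>S. mpoly_value p a = 0}"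

lemma zariski_closed_zero_set: "S \<subseteq> mpoly_ring n \<Longrightarrow> zariski_closed n (zero_set n S)"
  by (auto simp: zariski_closed_def zero_set_def)

lemma zariski_closedE:
  assumes "zariski_closed n V"
  obtains S where "S \<subseteq> mpoly_ring n" "V = zero_set n S"
  using assms by (auto simp: zariski_closed_def zero_set_def)

lemma zariski_closed_iff:
  "zariski_closed n V \<longleftrightarrow> V = zero_set n (vanishing_ideal n V)"
proof
  assume "zariski_closed n V"
  then obtain S where "S \<subseteq> mpoly_ring n" "V = zero_set n S" by (rule zariski_closedE)
  then show "V = zero_set n (vanishing_ideal n V)"
    by (auto simp: zero_set_def vanishing_ideal_def)
next
  assume "V = zero_set n (vanishing_ideal n V)"
  moreover have "vanishing_ideal n V \<subseteq> mpoly_ring n" by (auto simp: vanishing_ideal_def)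
  ultimately show "zariski_closed n V" using zariski_closed_zero_set by metis
qed

lemma vanishing_ideal_antimono: "V \<subseteq> W \<Longrightarrow> vanishing_ideal n W \<subseteq> vanishing_ideal n V"
  by (auto simp: vanishing_ideal_def)

lemma zariski_closed_separate:
  assumes "zariski_closed n V" "a \<in> affine_space n" "a \<notin> V"
  obtains p where "p \<in> vanishing_ideal n V" "mpoly_value p a \<noteq> 0"
  using assms unfolding zariski_closed_iff by (auto simp: zero_set_def)

lemma zariski_closed_subset: "zariski_closed n V \<Longrightarrow> V \<subseteq> affine_space n"
  by (auto elim!: zariski_closedE simp: zero_set_def)

lemma zariski_closed_Int:
  assumes "zariski_closed n V" "zariski_closed n W"
  shows "zariski_closed n (V \<inter> W)"
proof -
  obtain S T where "S \<subseteq> mpoly_ring n" "V = zero_set n S" "T \<subseteq> mpoly_ring n" "W = zero_set n T"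
    using assms by (meson zariski_closedE)
  moreover from this have "V \<inter> W = zero_set n (S \<union> T)" by (auto simp: zero_set_def)
  ultimately show ?thesis using zariski_closed_zero_set[of "S \<union> T" n] by simp
qed

lemma zariski_closed_Un:
  assumes "zariski_closed n V" "zariski_closed n W"
  shows "zariski_closed n (V \<union> W)"
proof -
  obtain S T where ST: "S \<subseteq> mpoly_ring n" "V = zero_set n S" "T \<subseteq> mpoly_ring n" "W = zero_set n T"
    using assms by (meson zariski_closedE)
  define P where "P = {p * q | p q. p \<in> S \<and> q \<in> T}"
  have "V \<union> W = zero_set n P"
    by (auto simp: P_def ST zero_set_def mpoly_eval_mult[OF hom_on_id]) (metis mpoly_eval_mult[OF hom_on_id] mult_eq_0_iff)
  moreover have "P \<subseteq> mpoly_ring n" using ST mpoly_ring_mult unfolding P_def by blast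
  ultimately show ?thesis by (simp add: zariski_closed_zero_set)
qed

lemma zariski_closed_Union:
  assumes "finite F" "\<And>V. V \<in> F \<Longrightarrow> zariski_closed n V"
  shows "zariski_closed n (\<Union>F)"
  using assms
proof (induction F rule: finite_induct)
  case empty
  have "zero_set n {1 :: 'a mpoly} = {}" by (simp add: zero_set_def mpoly_eval_1[OF hom_on_id])
  then show ?case
    using zariski_closed_zero_set[of "{1 :: 'a mpoly}" n] subring_setD(2)[OF subring_set_mpoly_ring]
    by auto
qed (simp add: zariski_closed_Un)

lemma zariski_closed_hypersurface:
  "f \<in> mpoly_ring n \<Longrightarrow> zariski_closed n {a \<in> affine_space n. mpoly_value f a = 0}"
  using zariski_closed_zero_set[of "{f}" n] by (simp add: zero_set_def)

text \<open>The intersection defining the closure may be infinite, so it is identified with one zero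
  set, that of the vanishing ideal of \<open>Y\<close>. If \<open>Y\<close> were not inside
  \<open>affine_space n\<close>, no closed set would contain it and the intersection would be all
  lists.\<close>

lemma zariski_closure_closed:
  assumes "Y \<subseteq> affine_space n"
  shows "zariski_closed n (zariski_closure n Y)"
proof -
  have "zariski_closure n Y = zero_set n (vanishing_ideal n Y)"
  proof
    show "zariski_closure n Y \<subseteq> zero_set n (vanishing_ideal n Y)"
      unfolding zariski_closure_def using assms
      by (intro Inter_lower CollectI conjI zariski_closed_zero_set)
        (auto simp: vanishing_ideal_def zero_set_def)
    have "zero_set n (vanishing_ideal n Y) \<subseteq> V" if V: "zariski_closed n V" "Y \<subseteq> V" for V
    proof -
      have "zero_set n (vanishing_ideal n Y) \<subseteq> zero_set n (vanishing_ideal n V)"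
        using vanishing_ideal_antimono[OF V(2)] by (auto simp: zero_set_def)
      then show ?thesis using V(1) zariski_closed_iff by blast
    qed
    then show "zero_set n (vanishing_ideal n Y) \<subseteq> zariski_closure n Y"
      unfolding zariski_closure_def by (intro Inter_greatest) auto
  qed
  moreover have "vanishing_ideal n Y \<subseteq> mpoly_ring n" by (auto simp: vanishing_ideal_def)
  ultimately show ?thesis by (simp add: zariski_closed_zero_set)
qed

lemma zariski_closure_superset: "Y \<subseteq> zariski_closure n Y"
  by (auto simp: zariski_closure_def)

lemma zariski_closure_least: "zariski_closed n V \<Longrightarrow> Y \<subseteq> V \<Longrightarrow> zariski_closure n Y \<subseteq> V"
  by (auto simp: zariski_closure_def)

lemma constructible_subset: "constructible n Y \<Longrightarrow> Y \<subseteq> affine_space n"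
  by (induction rule: constructible.induct) (auto dest: zariski_closed_subset)

text \<open>Primality of the vanishing ideal: otherwise the hypersurfaces of \<open>f\<close> and
  \<open>g\<close> would cover \<open>V\<close>, and irreducibility would put \<open>V\<close>
  inside one of them.\<close>

lemma affine_variety_mult_nonvanishing:
  assumes "affine_variety n V" "f \<in> mpoly_ring n" "g \<in> mpoly_ring n"
    and "f \<notin> vanishing_ideal n V" "g \<notin> vanishing_ideal n V"
  shows "f * g \<notin> vanishing_ideal n V"
proof
  let ?H = "\<lambda>f. {a \<in> affine_space n. mpoly_value f a = 0}"
  assume "f * g \<in> vanishing_ideal n V"
  then have "V \<subseteq> ?H f \<union> ?H g"
    using assms(1) by (auto simp: vanishing_ideal_def mpoly_eval_mult[OF hom_on_id] affine_variety_def
        dest!: zariski_closed_subset)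
  then have "V \<subseteq> ?H f \<or> V \<subseteq> ?H g"
    using assms zariski_closed_hypersurface unfolding affine_variety_def by blast
  then show False using assms by (auto simp: vanishing_ideal_def)
qed

lemma affine_variety_subset_Union:
  assumes "affine_variety n V" "finite F" "\<And>W. W \<in> F \<Longrightarrow> zariski_closed n W" "V \<subseteq> \<Union>F"
  shows "\<exists>W\<in>F. V \<subseteq> W"
  using assms(2-)
proof (induction F rule: finite_induct)
  case empty
  then show ?case using assms(1) by (auto simp: affine_variety_def)
next
  case (insert W F)
  have "V \<subseteq> W \<or> V \<subseteq> \<Union>F"
    using assms(1) insert.prems zariski_closed_Union[OF insert.hyps(1), of n]
    unfolding affine_variety_def by simp
  then show ?case using insert by auto
qed


section \<open>Specialisations\<close>

definition polys_over :: "'l::comm_ring_1 set \<Rightarrow> 'l poly set" where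
  "polys_over A = {p. \<forall>i. coeff p i \<in> A}"

text \<open>Folding this over a list yields the finitely generated algebra to which homomorphisms
  are extended one generator at a time.\<close>

definition adjoin :: "'l::comm_ring_1 set \<Rightarrow> 'l \<Rightarrow> 'l set" where
  "adjoin A b = {poly p b | p. p \<in> polys_over A}"

lemma subring_set_polys_over:
  assumes "subring_set A"
  shows "subring_set (polys_over A)"
  unfolding subring_set_def polys_over_def
  using assms by (auto simp: subring_setD coeff_mult intro!: subring_set_sum)

lemma polys_over_monom: "subring_set A \<Longrightarrow> c \<in> A \<Longrightarrow> monom c k \<in> polys_over A"
  by (simp add: polys_over_def subring_setD)

lemma polys_over_const: "subring_set A \<Longrightarrow> c \<in> A \<Longrightarrow> [:c:] \<in> polys_over A"
  using polys_over_monom[of A c 0] by (simp add: monom_0)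

lemma polys_over_smult: "subring_set A \<Longrightarrow> c \<in> A \<Longrightarrow> p \<in> polys_over A \<Longrightarrow> smult c p \<in> polys_over A"
  by (simp add: polys_over_def subring_setD)

lemma polys_over_diff:
  assumes "subring_set A" "p \<in> polys_over A" "q \<in> polys_over A"
  shows "p - q \<in> polys_over A"
  using subring_setD(3,4)[OF subring_set_polys_over[OF assms(1)]] assms(2,3) by (metis diff_conv_add_uminus)

lemma subring_set_adjoin:
  assumes "subring_set A"
  shows "subring_set (adjoin A b)"
proof -
  note R = subring_setD[OF subring_set_polys_over[OF assms]]
  show ?thesis
    unfolding subring_set_def adjoin_def
  proof (safe, goal_cases)
    case 1 show ?case by (rule exI[of _ 0]) (simp add: R)
  next
    case 2 show ?case by (rule exI[of _ 1]) (simp add: R)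
  next
    case (3 _ p) then show ?case by (intro exI[of _ "- p"]) (simp add: R)
  next
    case (4 _ _ p q) then show ?case by (intro exI[of _ "p + q"]) (simp add: R)
  next
    case (5 _ _ p q) then show ?case by (intro exI[of _ "p * q"]) (simp add: R)
  qed
qed

lemma subset_adjoin: "subring_set A \<Longrightarrow> A \<subseteq> adjoin A b"
  unfolding adjoin_def by (auto intro!: exI[of _ "[:_:]"] polys_over_const)

lemma generator_in_adjoin: "subring_set A \<Longrightarrow> b \<in> adjoin A b"
  unfolding adjoin_def by (auto intro!: exI[of _ "monom 1 1"] polys_over_monom simp: poly_monom subring_setD)

context
  fixes A :: "'l::comm_ring_1 set" and \<phi> :: "'l \<Rightarrow> 'k::comm_ring_1"
  assumes A: "subring_set A" and \<phi>: "hom_on A \<phi>"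
begin

lemma map_poly_hom_add:
  assumes "p \<in> polys_over A" "q \<in> polys_over A"
  shows "map_poly \<phi> (p + q) = map_poly \<phi> p + map_poly \<phi> q"
  using assms by (intro poly_eqI) (simp add: coeff_map_poly hom_onD[OF \<phi>] polys_over_def)

lemma map_poly_hom_mult:
  assumes "p \<in> polys_over A" "q \<in> polys_over A"
  shows "map_poly \<phi> (p * q) = map_poly \<phi> p * map_poly \<phi> q"
proof (rule poly_eqI)
  fix n
  have "\<phi> (\<Sum>i\<le>n. coeff p i * coeff q (n - i)) = (\<Sum>i\<le>n. \<phi> (coeff p i * coeff q (n - i)))"
    using assms by (intro hom_on_sum[OF A \<phi>] subring_setD(5)[OF A]) (auto simp: polys_over_def)
  then show "coeff (map_poly \<phi> (p * q)) n = coeff (map_poly \<phi> p * map_poly \<phi> q) n"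
    using assms by (simp add: coeff_map_poly hom_onD[OF \<phi>] coeff_mult polys_over_def)
qed

lemma map_poly_hom_const: "map_poly \<phi> [:c:] = [:\<phi> c:]"
  by (intro poly_eqI) (simp add: coeff_map_poly hom_onD[OF \<phi>] coeff_pCons split: nat.split)

lemma map_poly_hom_smult:
  assumes "c \<in> A" "p \<in> polys_over A"
  shows "map_poly \<phi> (smult c p) = smult (\<phi> c) (map_poly \<phi> p)"
  using assms by (intro poly_eqI) (simp add: coeff_map_poly hom_onD[OF \<phi>] polys_over_def)

text \<open>Universal property of \<open>A[b]\<close> as a quotient of \<open>A[X]\<close>:
  polynomials with the same value at \<open>b\<close> differ by a relation, and \<open>\<xi>\<close>
  satisfies the image of every relation, so the choice of a representative does not matter.\<close>

lemma hom_adjoin: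
  assumes "\<And>p. p \<in> polys_over A \<Longrightarrow> poly p b = 0 \<Longrightarrow> poly (map_poly \<phi> p) \<xi> = 0"
  shows "\<exists>\<psi>. hom_on (adjoin A b) \<psi> \<and> (\<forall>p\<in>polys_over A. \<psi> (poly p b) = poly (map_poly \<phi> p) \<xi>)"
proof -
  note R = subring_setD[OF subring_set_polys_over[OF A]]
  define \<psi> where "\<psi> x = poly (map_poly \<phi> (SOME p. p \<in> polys_over A \<and> poly p b = x)) \<xi>" for x
  have \<psi>: "\<psi> (poly p b) = poly (map_poly \<phi> p) \<xi>" if p: "p \<in> polys_over A" for p
  proof -
    define q where "q = (SOME q. q \<in> polys_over A \<and> poly q b = poly p b)"
    have q: "q \<in> polys_over A" "poly q b = poly p b"
      using someI[of "\<lambda>q. q \<in> polys_over A \<and> poly q b = poly p b" p] p by (auto simp: q_def)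
    have d: "q - p \<in> polys_over A" using polys_over_diff[OF A] p q by auto
    have "map_poly \<phi> q = map_poly \<phi> (q - p) + map_poly \<phi> p"
      using map_poly_hom_add[OF d p] by simp
    moreover have "poly (map_poly \<phi> (q - p)) \<xi> = 0" using assms[OF d] q by simp
    ultimately show ?thesis by (simp add: \<psi>_def q_def)
  qed
  have "hom_on (adjoin A b) \<psi>"
    unfolding hom_on_def adjoin_def
  proof (safe, goal_cases)
    case 1 show ?case using \<psi>[of 0] R by simp
  next
    case 2 show ?case using \<psi>[of 1] R map_poly_hom_const[of 1]
      by (simp add: hom_onD[OF \<phi>] flip: one_pCons)
  next
    case (3 _ _ p q) then show ?case using \<psi>[of "p + q"] by (simp add: R \<psi> map_poly_hom_add)
  next
    case (4 _ _ p q) then show ?case using \<psi>[of "p * q"] by (simp add: R \<psi> map_poly_hom_mult)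
  qed
  with \<psi> show ?thesis by blast
qed

end

text \<open>Elements of \<open>A\<close> cannot be inverted, so each cancellation of a leading term
  first multiplies \<open>f\<close> by the leading coefficient of \<open>g\<close>.\<close>

lemma pseudo_division_over:
  fixes f g :: "'l::idom poly"
  assumes A: "subring_set A" and g: "g \<in> polys_over A" "g \<noteq> 0" and f: "f \<in> polys_over A"
  shows "\<exists>k s r. s \<in> polys_over A \<and> r \<in> polys_over A \<and>
           smult (lead_coeff g ^ k) f = s * g + r \<and> (r = 0 \<or> degree r < degree g)"
  using f
proof (induction "degree f" arbitrary: f rule: less_induct)
  case less
  note R = subring_setD[OF subring_set_polys_over[OF A]]
  let ?c = "lead_coeff g"
  have cA: "?c \<in> A" using g by (simp add: polys_over_def)
  show ?case
  proof (cases "degree f < degree g")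
    case True
    then show ?thesis using less.prems R by (intro exI[of _ 0] exI[of _ f]) auto
  next
    case False
    define s where "s = monom (lead_coeff f) (degree f - degree g)"
    define f' where "f' = smult ?c f - s * g"
    have s: "s \<in> polys_over A"
      using less.prems by (auto simp: s_def polys_over_def subring_setD[OF A])
    have f': "f' \<in> polys_over A"
      unfolding f'_def using less.prems g s cA by (intro polys_over_diff[OF A] polys_over_smult[OF A] R)
    have fs: "smult ?c f = f' + s * g" by (simp add: f'_def)
    have "degree f' \<le> degree f"
      unfolding f'_def s_def using False
      by (intro degree_diff_le degree_smult_le order.trans[OF degree_mult_le] order.trans[OF add_right_mono[OF degree_monom_le]]) auto
    moreover have "coeff f' (degree f) = 0"
      using False by (simp add: f'_def s_def coeff_monom_mult)
    ultimately consider "f' = 0" | "degree f' < degree f"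
      using eq_zero_or_degree_less by blast
    then show ?thesis
    proof cases
      case 1
      then show ?thesis using fs s R by (intro exI[of _ 1] exI[of _ s] exI[of _ 0]) auto
    next
      case 2
      from less.hyps[OF 2 f'] obtain k s' r where
        k: "s' \<in> polys_over A" "r \<in> polys_over A" "smult (?c ^ k) f' = s' * g + r"
          "r = 0 \<or> degree r < degree g" by blast
      have "smult (?c ^ Suc k) f = smult (?c ^ k) (f' + s * g)"
        unfolding fs[symmetric] by (simp add: mult.commute)
      also have "\<dots> = (s' + smult (?c ^ k) s) * g + r"
        using k(3) by (simp add: algebra_simps smult_add_right)
      finally have "smult (?c ^ Suc k) f = (s' + smult (?c ^ k) s) * g + r" .
      moreover have "s' + smult (?c ^ k) s \<in> polys_over A"
        using k(1) s by (intro R(4) polys_over_smult[OF A] subring_set_power[OF A cA])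
      ultimately show ?thesis using k(2,4) by blast
    qed
  qed
qed

lemma poly_nonzero_value:
  fixes p :: "'k::alg_closed_field poly"
  assumes "p \<noteq> 0"
  shows "\<exists>x. poly p x \<noteq> 0"
proof -
  \<comment> \<open>The polynomial is \<open>1 + X * p\<close>; at a root \<open>x\<close> the
    product \<open>x * p(x)\<close> is -1.\<close>
  have "degree (pCons 1 p) > 0" using assms by simp
  from alg_closed_imp_poly_has_root[OF this] obtain x where "1 + x * poly p x = 0" by auto
  then show ?thesis by (intro exI[of _ x]) auto
qed

text \<open>The constant produced here is a combination of the minimal polynomial \<open>g\<close> of \<open>b\<close> and a
  polynomial \<open>c\<close> not vanishing at \<open>b\<close>: over the fraction field the two are coprime.\<close>

lemma bezout_min_poly:
  fixes g c :: "'l::idom poly"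
  assumes A: "subring_set A" and g: "g \<in> polys_over A" "g \<noteq> 0" "poly g b = 0"
    and min: "\<And>p. p \<in> polys_over A \<Longrightarrow> p \<noteq> 0 \<Longrightarrow> poly p b = 0 \<Longrightarrow> degree g \<le> degree p"
    and c: "c \<in> polys_over A" "poly c b \<noteq> 0"
  obtains e s t where "e \<in> A" "e \<noteq> 0" "s \<in> polys_over A" "t \<in> polys_over A" "s * c + t * g = [:e:]"
proof -
  note R = subring_setD[OF subring_set_polys_over[OF A]]
  define J where "J = {s * c + t * g | s t. s \<in> polys_over A \<and> t \<in> polys_over A}"
  have JA: "J \<subseteq> polys_over A" using R g c by (auto simp: J_def)
  have cJ: "c \<in> J" unfolding J_def using R by (intro CollectI exI[of _ 1] exI[of _ 0]) auto
  have gJ: "g \<in> J" unfolding J_def using R by (intro CollectI exI[of _ 0] exI[of _ 1]) auto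
  have J_comb: "smult a p - q * p' \<in> J" if pp: "p \<in> J" "p' \<in> J" "a \<in> A" "q \<in> polys_over A" for a p q p'
  proof -
    obtain s t s' t' where st: "s \<in> polys_over A" "t \<in> polys_over A" "s' \<in> polys_over A" "t' \<in> polys_over A"
      "p = s * c + t * g" "p' = s' * c + t' * g" using pp by (auto simp: J_def)
    have "smult a p - q * p' = (smult a s - q * s') * c + (smult a t - q * t') * g"
      by (simp add: st algebra_simps smult_add_right)
    moreover have "smult a s - q * s' \<in> polys_over A" "smult a t - q * t' \<in> polys_over A"
      using st pp by (auto intro!: polys_over_diff[OF A] polys_over_smult[OF A] R)
    ultimately show ?thesis unfolding J_def by blast
  qed
  \<comment> \<open>\<open>e\<close> stands in for the gcd of \<open>c\<close> and \<open>g\<close>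
    over the fraction field: its minimal degree in \<open>J\<close> makes all pseudo-remainders
    vanish.\<close>
  define e where "e = arg_min degree (\<lambda>p. p \<in> J \<and> p \<noteq> 0)"
  have e: "e \<in> J" "e \<noteq> 0" and emin: "\<And>p. p \<in> J \<Longrightarrow> p \<noteq> 0 \<Longrightarrow> degree e \<le> degree p"
    using arg_min_nat_lemma[of "\<lambda>p. p \<in> J \<and> p \<noteq> 0" g degree] gJ g(2) by (auto simp: e_def)
  have eA: "e \<in> polys_over A" using e JA by auto
  have div: "\<exists>k q. q \<in> polys_over A \<and> smult (lead_coeff e ^ k) p = q * e" if p: "p \<in> J" for p
  proof -
    obtain k q r where kq: "q \<in> polys_over A" "smult (lead_coeff e ^ k) p = q * e + r"
      "r = 0 \<or> degree r < degree e"
      using pseudo_division_over[OF A eA e(2), of p] p JA by blast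
    have "r = smult (lead_coeff e ^ k) p - q * e" using kq by simp
    also have "\<dots> \<in> J"
      using p e kq eA by (intro J_comb subring_set_power[OF A]) (auto simp: polys_over_def)
    finally have "r = 0" using kq(3) emin by force
    with kq show ?thesis by auto
  qed
  obtain k q where kq: "q \<in> polys_over A" "smult (lead_coeff e ^ k) g = q * e" using div[OF gJ] by blast
  obtain k' q' where kq': "smult (lead_coeff e ^ k') c = q' * e" using div[OF cJ] by blast
  have "poly e b \<noteq> 0"
  proof
    assume "poly e b = 0"
    then have "poly (smult (lead_coeff e ^ k') c) b = 0" by (simp add: kq')
    then show False using c e by simp
  qed
  moreover have "poly q b * poly e b = 0" using arg_cong[OF kq(2), of "\<lambda>p. poly p b"] g by simp
  ultimately have qb: "poly q b = 0" by simp
  have "smult (lead_coeff e ^ k) g \<noteq> 0" using g e by simp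
  then have q0: "q \<noteq> 0" by (auto simp: kq(2))
  \<comment> \<open>\<open>q\<close> still kills \<open>b\<close>, so a positive degree of
    \<open>e\<close> would make \<open>q\<close> a relation of smaller degree than
    \<open>g\<close>.\<close>
  have "degree g = degree q + degree e"
    using arg_cong[OF kq(2), of degree] q0 e by (simp add: degree_mult_eq)
  with min[OF kq(1) q0 qb] have "degree e = 0" by simp
  then obtain e0 where e0: "e = [:e0:]" by (rule degree_eq_zeroE)
  have "e0 = coeff e 0" by (simp add: e0)
  then have "e0 \<in> A" using eA by (auto simp: polys_over_def)
  moreover obtain s t where "s \<in> polys_over A" "t \<in> polys_over A" "s * c + t * g = [:e0:]"
    using e(1) e0 by (auto simp: J_def)
  ultimately show ?thesis using that e(2) e0 by auto
qed

text \<open>The condition that \<open>c\<close> stay nonzero is traded for one element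
  \<open>c'\<close> of \<open>A\<close>, chosen independently of \<open>\<phi>\<close>; this
  uniformity lets the condition be pushed down generator by generator.\<close>

lemma hom_extend_adjoin:
  fixes A :: "'l::idom set"
  assumes A: "subring_set A" and c: "c \<in> adjoin A b" "c \<noteq> 0"
  shows "\<exists>c'\<in>A. c' \<noteq> 0 \<and> (\<forall>\<phi> :: 'l \<Rightarrow> 'k::alg_closed_field. hom_on A \<phi> \<and> \<phi> c' \<noteq> 0 \<longrightarrow>
           (\<exists>\<psi>. hom_on (adjoin A b) \<psi> \<and> (\<forall>x\<in>A. \<psi> x = \<phi> x) \<and> \<psi> c \<noteq> 0))"
proof -
  note R = subring_setD[OF subring_set_polys_over[OF A]]
  obtain C where C: "C \<in> polys_over A" "c = poly C b" using c by (auto simp: adjoin_def)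
  have finish: "\<exists>\<psi>. hom_on (adjoin A b) \<psi> \<and> (\<forall>x\<in>A. \<psi> x = \<phi> x) \<and> \<psi> c \<noteq> 0"
    if \<phi>: "hom_on A \<phi>" and 0: "\<And>p. p \<in> polys_over A \<Longrightarrow> poly p b = 0 \<Longrightarrow> poly (map_poly \<phi> p) \<xi> = 0"
      and nz: "poly (map_poly \<phi> C) \<xi> \<noteq> 0" for \<phi> :: "'l \<Rightarrow> 'k" and \<xi>
  proof -
    from hom_adjoin[OF A \<phi>, of b \<xi>] 0 obtain \<psi> where \<psi>: "hom_on (adjoin A b) \<psi>"
      "\<And>p. p \<in> polys_over A \<Longrightarrow> \<psi> (poly p b) = poly (map_poly \<phi> p) \<xi>" by blast
    have "\<psi> x = \<phi> x" if "x \<in> A" for x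
      using \<psi>(2)[OF polys_over_const[OF A that]] by (simp add: map_poly_hom_const[OF A \<phi>])
    then show ?thesis using \<psi> C nz by auto
  qed
  show ?thesis
  proof (cases "\<exists>p\<in>polys_over A. p \<noteq> 0 \<and> poly p b = 0")
    \<comment> \<open>\<open>b\<close> is transcendental over \<open>A\<close>: there are no
      relations to respect, and \<open>\<xi>\<close> only has to avoid the zeros of the image of
      \<open>C\<close>.\<close>
    case False
    have "C \<noteq> 0" using C c by auto
    have "\<exists>\<psi>. hom_on (adjoin A b) \<psi> \<and> (\<forall>x\<in>A. \<psi> x = \<phi> x) \<and> \<psi> c \<noteq> 0"
      if \<phi>: "hom_on A \<phi>" "\<phi> (lead_coeff C) \<noteq> 0" for \<phi> :: "'l \<Rightarrow> 'k"
    proof -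
      have "coeff (map_poly \<phi> C) (degree C) \<noteq> 0" using \<phi> by (simp add: coeff_map_poly hom_onD[OF \<phi>(1)])
      then have "map_poly \<phi> C \<noteq> 0" by auto
      then obtain \<xi> where "poly (map_poly \<phi> C) \<xi> \<noteq> 0" using poly_nonzero_value by blast
      moreover have "poly (map_poly \<phi> p) \<xi> = 0" if "p \<in> polys_over A" "poly p b = 0" for p
        using False that by (metis map_poly_0 poly_0)
      ultimately show ?thesis using finish[OF \<phi>(1)] by blast
    qed
    then show ?thesis using C(1) \<open>C \<noteq> 0\<close>
      by (intro bexI[of _ "lead_coeff C"]) (auto simp: polys_over_def)
  next
    case True
    define P where "P p \<longleftrightarrow> p \<in> polys_over A \<and> p \<noteq> 0 \<and> poly p b = 0" for p
    define g where "g = arg_min degree P"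
    obtain p0 where "P p0" using True by (auto simp: P_def)
    have "P g" and gmin: "\<And>p. P p \<Longrightarrow> degree g \<le> degree p"
      using arg_min_nat_lemma[of P p0 degree] \<open>P p0\<close> by (auto simp: g_def)
    then have g: "g \<in> polys_over A" "g \<noteq> 0" "poly g b = 0" by (auto simp: P_def)
    have "degree g \<noteq> 0"
    proof
      assume "degree g = 0"
      then obtain d where "g = [:d:]" by (rule degree_eq_zeroE)
      with g show False by simp
    qed
    obtain e s t where e: "e \<in> A" "e \<noteq> 0" "s \<in> polys_over A" "t \<in> polys_over A" "s * C + t * g = [:e:]"
      by (rule bezout_min_poly[OF A g _ C(1)]) (use gmin C c in \<open>auto simp: P_def\<close>)
    \<comment> \<open>The constant will be \<open>?d * e\<close>. A nonzero \<open>\<phi> ?d\<close>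
      keeps the degree of \<open>g\<close>, so that a root \<open>\<xi>\<close> exists, and can be
      cancelled after pseudo-division; a nonzero \<open>\<phi> e\<close> keeps \<open>C\<close> from
      vanishing at \<open>\<xi>\<close>, by the Bezout identity.\<close>
    let ?d = "lead_coeff g"
    have dA: "?d \<in> A" using g by (simp add: polys_over_def)
    have "\<exists>\<psi>. hom_on (adjoin A b) \<psi> \<and> (\<forall>x\<in>A. \<psi> x = \<phi> x) \<and> \<psi> c \<noteq> 0"
      if \<phi>: "hom_on A \<phi>" "\<phi> (?d * e) \<noteq> 0" for \<phi> :: "'l \<Rightarrow> 'k"
    proof -
      have nz: "\<phi> ?d \<noteq> 0" "\<phi> e \<noteq> 0" using \<phi> hom_onD(4)[OF \<phi>(1) dA e(1)] by auto
      note mp = map_poly_hom_mult[OF A \<phi>(1)] map_poly_hom_add[OF A \<phi>(1)]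
        map_poly_hom_smult[OF A \<phi>(1)] map_poly_hom_const[OF A \<phi>(1)]
      have "coeff (map_poly \<phi> g) (degree g) \<noteq> 0"
        using nz by (simp add: coeff_map_poly hom_onD[OF \<phi>(1)])
      then have "degree (map_poly \<phi> g) > 0"
        using \<open>degree g \<noteq> 0\<close> le_degree[of "map_poly \<phi> g" "degree g"] by simp
      then obtain \<xi> where \<xi>: "poly (map_poly \<phi> g) \<xi> = 0" using alg_closed_imp_poly_has_root by blast
      have "poly (map_poly \<phi> p) \<xi> = 0" if p: "p \<in> polys_over A" "poly p b = 0" for p
      proof -
        obtain k q r where kq: "q \<in> polys_over A" "r \<in> polys_over A" "smult (?d ^ k) p = q * g + r"
          "r = 0 \<or> degree r < degree g"
          using pseudo_division_over[OF A g(1,2) p(1)] by blast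
        have "poly r b = 0" using arg_cong[OF kq(3), of "\<lambda>p. poly p b"] p g by simp
        with kq(2,4) gmin[of r] have "r = 0" unfolding P_def by linarith
        then have "map_poly \<phi> (smult (?d ^ k) p) = map_poly \<phi> (q * g)" using kq by simp
        then have "smult (\<phi> ?d ^ k) (map_poly \<phi> p) = map_poly \<phi> q * map_poly \<phi> g"
          using p(1) kq(1) g(1) dA by (simp add: mp subring_set_power[OF A] hom_on_power[OF A \<phi>(1)])
        from arg_cong[OF this, of "\<lambda>p. poly p \<xi>"] \<xi> nz show ?thesis by simp
      qed
      moreover have "poly (map_poly \<phi> C) \<xi> \<noteq> 0"
      proof -
        have "map_poly \<phi> (s * C + t * g) = [:\<phi> e:]" by (simp add: e(5) mp)
        then have "map_poly \<phi> s * map_poly \<phi> C + map_poly \<phi> t * map_poly \<phi> g = [:\<phi> e:]"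
          using e(3,4) g(1) C(1) by (simp add: mp R)
        from arg_cong[OF this, of "\<lambda>p. poly p \<xi>"] \<xi> nz show ?thesis by auto
      qed
      ultimately show ?thesis using finish[OF \<phi>(1)] by blast
    qed
    moreover have "?d * e \<in> A" "?d * e \<noteq> 0" using dA e g subring_setD(5)[OF A] by auto
    ultimately show ?thesis by blast
  qed
qed

lemma foldl_adjoin:
  fixes A :: "'l::idom set"
  assumes "subring_set A"
  shows "subring_set (foldl adjoin A bs) \<and> A \<subseteq> foldl adjoin A bs \<and> set bs \<subseteq> foldl adjoin A bs"
  using assms
proof (induction bs arbitrary: A)
  case (Cons b bs)
  from Cons.IH[OF subring_set_adjoin[OF Cons.prems, of b]]
    subset_adjoin[OF Cons.prems, of b] generator_in_adjoin[OF Cons.prems, of b]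
  show ?case by auto
qed simp

text \<open>Nonvanishing conditions descend from the last generator to the first, \<open>c\<close>
  to \<open>d\<close> to \<open>c'\<close>; homomorphisms are then extended in the opposite
  direction.\<close>

lemma hom_extend_foldl_adjoin:
  fixes A :: "'l::idom set"
  assumes "subring_set A" "c \<in> foldl adjoin A bs" "c \<noteq> 0"
  shows "\<exists>c'\<in>A. c' \<noteq> 0 \<and> (\<forall>\<phi> :: 'l \<Rightarrow> 'k::alg_closed_field. hom_on A \<phi> \<and> \<phi> c' \<noteq> 0 \<longrightarrow>
           (\<exists>\<psi>. hom_on (foldl adjoin A bs) \<psi> \<and> (\<forall>x\<in>A. \<psi> x = \<phi> x) \<and> \<psi> c \<noteq> 0))"
  using assms
proof (induction bs arbitrary: A)
  case Nil
  then show ?case by (intro bexI[of _ c]) auto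
next
  case (Cons b bs)
  let ?B = "adjoin A b"
  from Cons.IH[OF subring_set_adjoin[OF Cons.prems(1), of b]] Cons.prems obtain d where
    d: "d \<in> ?B" "d \<noteq> 0" "\<And>\<phi> :: 'l \<Rightarrow> 'k. hom_on ?B \<phi> \<Longrightarrow> \<phi> d \<noteq> 0 \<Longrightarrow>
      \<exists>\<psi>. hom_on (foldl adjoin ?B bs) \<psi> \<and> (\<forall>x\<in>?B. \<psi> x = \<phi> x) \<and> \<psi> c \<noteq> 0"
    by auto
  from hom_extend_adjoin[OF Cons.prems(1) d(1,2), where 'k = 'k] obtain c' where
    c': "c' \<in> A" "c' \<noteq> 0" "\<And>\<phi> :: 'l \<Rightarrow> 'k. hom_on A \<phi> \<Longrightarrow> \<phi> c' \<noteq> 0 \<Longrightarrow>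
      \<exists>\<psi>. hom_on ?B \<psi> \<and> (\<forall>x\<in>A. \<psi> x = \<phi> x) \<and> \<psi> d \<noteq> 0"
    by auto
  have "\<exists>\<psi>. hom_on (foldl adjoin A (b # bs)) \<psi> \<and> (\<forall>x\<in>A. \<psi> x = \<phi> x) \<and> \<psi> c \<noteq> 0"
    if "hom_on A \<phi>" "\<phi> c' \<noteq> 0" for \<phi> :: "'l \<Rightarrow> 'k"
  proof -
    from c'(3)[OF that] obtain \<psi> where \<psi>: "hom_on ?B \<psi>" "\<forall>x\<in>A. \<psi> x = \<phi> x" "\<psi> d \<noteq> 0" by blast
    from d(3)[OF \<psi>(1,3)] obtain \<psi>' where
      "hom_on (foldl adjoin ?B bs) \<psi>'" "\<forall>x\<in>?B. \<psi>' x = \<psi> x" "\<psi>' c \<noteq> 0" by blast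
    then show ?thesis using \<psi>(2) subset_adjoin[OF Cons.prems(1), of b] by (intro exI[of _ \<psi>']) auto
  qed
  with c' show ?case by blast
qed

section \<open>The Nullstellensatz and loci of points\<close>

lemma mpoly_eval_in_subring:
  assumes B: "subring_set B" and h: "range h \<subseteq> B" and a: "set a \<subseteq> B" and p: "p \<in> mpoly_ring (length a)"
  shows "mpoly_eval h p a \<in> B"
proof -
  have "a ! i \<in> B" if "m \<in> Poly_Mapping.keys p" "i \<in> Poly_Mapping.keys m" for i m
    using p that a by (force simp: mpoly_ring_def)
  then show ?thesis
    unfolding mpoly_eval_def using h
    by (intro subring_set_sum[OF B] subring_setD(5)[OF B] subring_set_prod[OF B] subring_set_power[OF B]) auto
qed

lemma mpoly_eval_hom:
  fixes h :: "'k::field \<Rightarrow> 'l::field" and \<psi> :: "'l \<Rightarrow> 'k"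
  assumes B: "subring_set B" "hom_on B \<psi>" and h: "range h \<subseteq> B" "\<And>c. \<psi> (h c) = c"
    and a: "set a \<subseteq> B" and p: "p \<in> mpoly_ring (length a)"
  shows "\<psi> (mpoly_eval h p a) = mpoly_value p (map \<psi> a)"
proof -
  let ?M = "\<lambda>m a. \<Prod>i\<in>Poly_Mapping.keys m. a ! i ^ Poly_Mapping.lookup m i"
  have ai: "a ! i \<in> B" "map \<psi> a ! i = \<psi> (a ! i)"
    if "m \<in> Poly_Mapping.keys p" "i \<in> Poly_Mapping.keys m" for i m
    using p that a by (force simp: mpoly_ring_def)+
  have hB: "h x \<in> B" for x using h(1) by auto
  have M: "?M m a \<in> B" "\<psi> (?M m a) = ?M m (map \<psi> a)" if m: "m \<in> Poly_Mapping.keys p" for m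
  proof -
    have pw: "a ! i ^ Poly_Mapping.lookup m i \<in> B" if "i \<in> Poly_Mapping.keys m" for i
      using ai(1)[OF m that] by (rule subring_set_power[OF B(1)])
    then show "?M m a \<in> B" by (rule subring_set_prod[OF B(1)])
    have "\<psi> (?M m a) = (\<Prod>i\<in>Poly_Mapping.keys m. \<psi> (a ! i ^ Poly_Mapping.lookup m i))"
      using pw by (rule hom_on_prod[OF B])
    also have "\<dots> = ?M m (map \<psi> a)"
      using ai[OF m] by (intro prod.cong refl) (simp add: hom_on_power[OF B])
    finally show "\<psi> (?M m a) = ?M m (map \<psi> a)" .
  qed
  have "\<psi> (mpoly_eval h p a) = (\<Sum>m\<in>Poly_Mapping.keys p. \<psi> (h (Poly_Mapping.lookup p m) * ?M m a))"
    unfolding mpoly_eval_def using M(1) hB by (intro hom_on_sum[OF B] subring_setD(5)[OF B(1)]) auto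
  also have "\<dots> = mpoly_value p (map \<psi> a)"
    unfolding mpoly_eval_def using M by (intro sum.cong refl) (simp add: hom_onD(4)[OF B(2) hB] h(2))
  finally show ?thesis .
qed

text \<open>The algebra generated by \<open>a\<close> over the copy \<open>range h\<close> of the
  field maps back to the field without killing \<open>q(a)\<close>: the element controlling the
  extension is now a nonzero constant, which the inverse \<open>g\<close> of \<open>h\<close> cannot
  send to 0.\<close>

theorem specialisation_exists:
  fixes h :: "'k::alg_closed_field \<Rightarrow> 'l::field"
  assumes h: "hom_on UNIV h" and q: "q \<in> mpoly_ring (length a)" "mpoly_eval h q a \<noteq> 0"
  shows "\<exists>v\<in>affine_space (length a).
           (\<forall>p\<in>mpoly_ring (length a). mpoly_eval h p a = 0 \<longrightarrow> mpoly_value p v = 0) \<and> mpoly_value q v \<noteq> 0"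
proof -
  have A: "subring_set (range h)"
    unfolding subring_set_def
    using hom_onD(1,2)[OF h] hom_on_uminus[OF subring_set_UNIV h]
    by (auto simp: hom_onD(3,4)[OF h, symmetric] image_iff) metis+
  define B where "B = foldl adjoin (range h) a"
  have B: "subring_set B" "range h \<subseteq> B" "set a \<subseteq> B" using foldl_adjoin[OF A, of a] by (auto simp: B_def)
  define g where "g = inv_into UNIV h"
  have g: "g (h c) = c" for c using field_hom_inj[OF h] by (simp add: g_def)
  have "g 0 = 0" "g 1 = 1" using g[of 0] g[of 1] hom_onD(1,2)[OF h] by auto
  then have g_hom: "hom_on (range h) g"
    unfolding hom_on_def by (auto simp: g hom_onD(3,4)[OF h, symmetric])
  have qB: "mpoly_eval h q a \<in> B" using mpoly_eval_in_subring B q(1) by blast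
  from hom_extend_foldl_adjoin[OF A, of "mpoly_eval h q a" a, where 'k = 'k] qB q obtain c' where
    c': "c' \<in> range h" "c' \<noteq> 0" "\<And>\<phi> :: 'l \<Rightarrow> 'k. hom_on (range h) \<phi> \<Longrightarrow> \<phi> c' \<noteq> 0 \<Longrightarrow>
      \<exists>\<psi>. hom_on B \<psi> \<and> (\<forall>x\<in>range h. \<psi> x = \<phi> x) \<and> \<psi> (mpoly_eval h q a) \<noteq> 0"
    by (auto simp: B_def)
  have "g c' \<noteq> 0" using c' g hom_onD(1)[OF h] by auto
  from c'(3)[OF g_hom this] obtain \<psi> where
    \<psi>: "hom_on B \<psi>" "\<And>c. \<psi> (h c) = c" "\<psi> (mpoly_eval h q a) \<noteq> 0" by (auto simp: g)
  note ev = mpoly_eval_hom[OF B(1) \<psi>(1) B(2) \<psi>(2) B(3)]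
  show ?thesis
  proof (rule bexI[of _ "map \<psi> a"], intro conjI ballI impI)
    show "mpoly_value p (map \<psi> a) = 0" if "p \<in> mpoly_ring (length a)" "mpoly_eval h p a = 0" for p
      using ev[OF that(1)] that(2) hom_onD(1)[OF \<psi>(1)] by simp
    show "mpoly_value q (map \<psi> a) \<noteq> 0" using ev[OF q(1)] \<psi>(3) by simp
  qed (simp add: affine_space_def)
qed

definition locus :: "'k::field univ_dom list \<Rightarrow> 'k list set" where
  "locus a = zero_set (length a) {p \<in> mpoly_ring (length a). mpoly_eval univ_emb p a = 0}"

text \<open>The nontrivial point is that a polynomial vanishing on the locus vanishes at
  \<open>a\<close>: otherwise \<open>specialisation_exists\<close>, with it as \<open>q\<close>,
  gives a point of the locus where it is nonzero.\<close>

lemma generic_point_locus: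
  fixes a :: "'k::alg_closed_field univ_dom list"
  shows "generic_point (length a) (locus a) a"
  using specialisation_exists[OF hom_on_univ_emb, of _ a]
  by (fastforce simp: generic_point_def affine_space_def locus_def zero_set_def)

text \<open>The vanishing ideal of the locus is the kernel of evaluation at \<open>a\<close>, which
  takes values in a field, hence prime. Nonemptiness is the Nullstellensatz for the polynomial
  1.\<close>

lemma affine_variety_locus:
  fixes a :: "'k::alg_closed_field univ_dom list"
  shows "affine_variety (length a) (locus a)"
proof -
  let ?n = "length a"
  have van: "mpoly_eval univ_emb p a = 0 \<longleftrightarrow> p \<in> vanishing_ideal ?n (locus a)"
    if "p \<in> mpoly_ring ?n" for p
    using generic_point_locus[of a] that by (auto simp: generic_point_def vanishing_ideal_def)
  have closed: "zariski_closed ?n (locus a)"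
    unfolding locus_def by (rule zariski_closed_zero_set) auto
  have "(1 :: 'k mpoly) \<in> mpoly_ring ?n" using subring_setD(2)[OF subring_set_mpoly_ring] .
  from specialisation_exists[OF hom_on_univ_emb this] have ne: "locus a \<noteq> {}"
    by (auto simp: mpoly_eval_1[OF hom_on_univ_emb] locus_def zero_set_def)
  have "locus a \<subseteq> A \<or> locus a \<subseteq> B"
    if AB: "zariski_closed ?n A" "zariski_closed ?n B" "locus a \<subseteq> A \<union> B" for A B
  proof (rule ccontr)
    assume "\<not> ?thesis"
    then obtain u v where uv: "u \<in> locus a" "u \<notin> A" "v \<in> locus a" "v \<notin> B" by auto
    then have uvn: "u \<in> affine_space ?n" "v \<in> affine_space ?n" by (auto simp: locus_def zero_set_def)
    obtain p where p: "p \<in> vanishing_ideal ?n A" "mpoly_value p u \<noteq> 0"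
      using zariski_closed_separate[OF AB(1) uvn(1) uv(2)] .
    obtain q where q: "q \<in> vanishing_ideal ?n B" "mpoly_value q v \<noteq> 0"
      using zariski_closed_separate[OF AB(2) uvn(2) uv(4)] .
    have pq: "p \<in> mpoly_ring ?n" "q \<in> mpoly_ring ?n" using p q by (auto simp: vanishing_ideal_def)
    have "mpoly_value (p * q) w = 0" if "w \<in> locus a" for w
      using that AB(3) p(1) q(1) by (auto simp: vanishing_ideal_def mpoly_eval_mult[OF hom_on_id])
    then have "mpoly_eval univ_emb (p * q) a = 0"
      using van[OF mpoly_ring_mult[OF pq]] mpoly_ring_mult[OF pq] by (auto simp: vanishing_ideal_def)
    then have "p \<in> vanishing_ideal ?n (locus a) \<or> q \<in> vanishing_ideal ?n (locus a)"
      using van pq by (auto simp: mpoly_eval_mult[OF hom_on_univ_emb])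
    then show False using p q uv by (auto simp: vanishing_ideal_def)
  qed
  with closed ne show ?thesis by (auto simp: affine_variety_def)
qed


section \<open>Closed sets form a Noetherian space\<close>

text \<open>Repeatedly take an index of least value beyond the last one chosen. Each later index was
  a candidate in the choice before, so the values never decrease.\<close>

lemma nat_seq_mono_subseq:
  fixes s :: "nat \<Rightarrow> nat"
  shows "\<exists>\<phi>::nat \<Rightarrow> nat. strict_mono \<phi> \<and> mono (\<lambda>k. s (\<phi> k))"
proof -
  define \<phi> where "\<phi> = rec_nat (arg_min s (\<lambda>_. True)) (\<lambda>_ x. arg_min s (\<lambda>i. x < i))"
  have \<phi>0: "s (\<phi> 0) \<le> s i" for i
    using arg_min_nat_lemma[of "\<lambda>_. True" i s] by (simp add: \<phi>_def)
  have \<phi>S: "\<phi> k < \<phi> (Suc k)" "\<phi> k < i \<Longrightarrow> s (\<phi> (Suc k)) \<le> s i" for k i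
    using arg_min_nat_lemma[of "\<lambda>i. \<phi> k < i" "Suc (\<phi> k)" s] by (simp_all add: \<phi>_def)
  have "s (\<phi> k) \<le> s (\<phi> (Suc k))" for k
  proof (cases k)
    case (Suc j)
    have "\<phi> j < \<phi> (Suc (Suc j))" using \<phi>S(1)[of j] \<phi>S(1)[of "Suc j"] by simp
    then show ?thesis using \<phi>S(2) Suc by blast
  qed (simp add: \<phi>0)
  then show ?thesis
    using \<phi>S(1) by (auto simp: strict_mono_Suc_iff mono_iff_le_Suc)
qed

lemma dickson_subseq:
  fixes f :: "nat \<Rightarrow> nat \<Rightarrow> nat"
  shows "\<exists>\<phi>::nat \<Rightarrow> nat. strict_mono \<phi> \<and> (\<forall>i<n. mono (\<lambda>k. f (\<phi> k) i))"
proof (induction n)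
  case 0
  show ?case by (intro exI[of _ id]) (auto simp: strict_mono_def)
next
  case (Suc n)
  then obtain \<phi> :: "nat \<Rightarrow> nat" where \<phi>: "strict_mono \<phi>" "\<forall>i<n. mono (\<lambda>k. f (\<phi> k) i)" by blast
  obtain \<psi> :: "nat \<Rightarrow> nat" where \<psi>: "strict_mono \<psi>" "mono (\<lambda>k. f (\<phi> (\<psi> k)) n)"
    using nat_seq_mono_subseq[of "\<lambda>k. f (\<phi> k) n"] by blast
  have "strict_mono (\<lambda>k. \<phi> (\<psi> k))" using \<phi>(1) \<psi>(1) by (auto simp: strict_mono_def)
  moreover have "mono (\<lambda>k. f (\<phi> (\<psi> k)) i)" if "i < Suc n" for i
  proof (cases "i = n")
    case False
    then have "mono (\<lambda>k. f (\<phi> k) i)" using \<phi>(2) that by auto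
    then show ?thesis using strict_mono_mono[OF \<psi>(1)] by (auto simp: mono_def)
  qed (simp add: \<psi>)
  ultimately show ?case by blast
qed

lemma dickson:
  fixes m :: "nat \<Rightarrow> (nat \<Rightarrow>\<^sub>0 nat)"
  assumes "\<And>k. Poly_Mapping.keys (m k) \<subseteq> {..<n}"
  obtains i j d where "i < j" "m j = m i + d" "Poly_Mapping.keys d \<subseteq> {..<n}"
proof -
  obtain \<phi> :: "nat \<Rightarrow> nat" where \<phi>: "strict_mono \<phi>" "\<forall>i<n. mono (\<lambda>k. Poly_Mapping.lookup (m (\<phi> k)) i)"
    using dickson_subseq[of n "\<lambda>k. Poly_Mapping.lookup (m k)"] by blast
  define d where "d = m (\<phi> 1) - m (\<phi> 0)"
  have out: "Poly_Mapping.lookup (m k) i = 0" if "\<not> i < n" for i k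
    using assms[of k] that by (auto simp: in_keys_iff)
  have "Poly_Mapping.lookup (m (\<phi> 0)) i \<le> Poly_Mapping.lookup (m (\<phi> 1)) i" for i
    by (cases "i < n") (use \<phi>(2) out in \<open>auto simp: mono_def\<close>)
  then have "m (\<phi> 1) = m (\<phi> 0) + d"
    by (intro poly_mapping_eqI) (simp add: d_def lookup_add lookup_minus)
  moreover have "Poly_Mapping.keys d \<subseteq> {..<n}"
  proof
    fix i assume "i \<in> Poly_Mapping.keys d"
    then show "i \<in> {..<n}" using out[of i] by (cases "i < n") (auto simp: d_def in_keys_iff lookup_minus)
  qed
  moreover have "\<phi> 0 < \<phi> 1" using \<phi>(1) by (simp add: strict_mono_def)
  ultimately show ?thesis using that by blast
qed

lemma monomial_nonneg: "(0 :: nat \<Rightarrow>\<^sub>0 nat) \<le> d"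
proof -
  have "\<not> d < 0" by (auto simp: less_poly_mapping.rep_eq less_fun_def)
  then show ?thesis by simp
qed

text \<open>The order is lexicographic and has infinite descents when all variables are allowed.
  With \<open>n\<close> variables, Dickson's lemma finds in a descending sequence an earlier term
  dividing a later one, which is then not smaller.\<close>

lemma wf_monomials:
  "wf {(m, m' :: nat \<Rightarrow>\<^sub>0 nat). m < m' \<and> Poly_Mapping.keys m \<subseteq> {..<n} \<and> Poly_Mapping.keys m' \<subseteq> {..<n}}"
  unfolding wf_iff_no_infinite_down_chain
proof (rule notI, elim exE)
  fix m :: "nat \<Rightarrow> (nat \<Rightarrow>\<^sub>0 nat)"
  assume m: "\<forall>i. (m (Suc i), m i) \<in>
    {(m, m'). m < m' \<and> Poly_Mapping.keys m \<subseteq> {..<n} \<and> Poly_Mapping.keys m' \<subseteq> {..<n}}"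
  then have "Poly_Mapping.keys (m k) \<subseteq> {..<n}" for k by auto
  then obtain i j d where ij: "i < j" "m j = m i + d" by (rule dickson)
  have "m (Suc k) < m k" for k using m by auto
  with ij(1) have "m j < m i" by (induction i j rule: less_Suc_induct) (auto intro: less_trans)
  moreover have "m i \<le> m j" using monomial_nonneg[of d] add_left_mono[of 0 d "m i"] ij(2) by simp
  ultimately show False by simp
qed

lemma lookup_single_times:
  fixes p :: "'k::comm_ring_1 mpoly"
  shows "Poly_Mapping.lookup (Poly_Mapping.single d c * p) (d + m) = c * Poly_Mapping.lookup p m"
proof -
  have "Poly_Mapping.single d c * p =
      Poly_Mapping.single d c * (\<Sum>m\<in>Poly_Mapping.keys p. Poly_Mapping.single m (Poly_Mapping.lookup p m))"
    by (simp flip: mpoly_eq_sum_singles)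
  also have "\<dots> = (\<Sum>m\<in>Poly_Mapping.keys p. Poly_Mapping.single (d + m) (c * Poly_Mapping.lookup p m))"
    by (simp add: sum_distrib_left mult_single)
  finally show ?thesis
    by (auto simp: lookup_sum lookup_single when_def in_keys_iff)
qed

text \<open>One division step, with \<open>Max\<close> of the keys as leading monomial and
  \<open>c\<close> the quotient of the leading coefficients. The order is compatible with addition
  of exponents, so no larger terms appear.\<close>

lemma leading_monomial_reduce:
  fixes p q :: "'k::field mpoly"
  assumes p: "p \<noteq> 0" and q: "q \<noteq> 0"
    and d: "Max (Poly_Mapping.keys q) = Max (Poly_Mapping.keys p) + d"
  obtains c where "q - Poly_Mapping.single d c * p = 0 \<or>
    Max (Poly_Mapping.keys (q - Poly_Mapping.single d c * p)) < Max (Poly_Mapping.keys q)"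
proof -
  let ?lp = "Max (Poly_Mapping.keys p)" and ?lq = "Max (Poly_Mapping.keys q)"
  define c where "c = Poly_Mapping.lookup q ?lq / Poly_Mapping.lookup p ?lp"
  let ?r = "q - Poly_Mapping.single d c * p"
  have "?lp \<in> Poly_Mapping.keys p" using p by (intro Max_in) auto
  then have "Poly_Mapping.lookup p ?lp \<noteq> 0" by (simp add: in_keys_iff)
  then have "Poly_Mapping.lookup ?r ?lq = 0"
    using lookup_single_times[of d c p ?lp] by (simp add: lookup_minus d c_def add.commute)
  then have nlq: "?lq \<notin> Poly_Mapping.keys ?r" by (simp add: in_keys_iff)
  have le: "k \<le> ?lq" if k: "k \<in> Poly_Mapping.keys ?r" for k
  proof -
    have "k \<in> Poly_Mapping.keys q \<or> k \<in> Poly_Mapping.keys (Poly_Mapping.single d c * p)"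
      using k by (auto simp: in_keys_iff lookup_minus)
    then show ?thesis
    proof
      assume "k \<in> Poly_Mapping.keys (Poly_Mapping.single d c * p)"
      then obtain m where m: "k = d + m" "m \<in> Poly_Mapping.keys p"
        using Poly_Mapping.keys_mult[of "Poly_Mapping.single d c" p] by (auto split: if_splits)
      then have "m \<le> ?lp" by simp
      then show ?thesis using m(1) d by (simp add: add.commute add_left_mono)
    qed simp
  qed
  have "?r = 0 \<or> Max (Poly_Mapping.keys ?r) < ?lq"
  proof (cases "?r = 0")
    case False
    then have "Max (Poly_Mapping.keys ?r) \<in> Poly_Mapping.keys ?r" by (intro Max_in) auto
    then show ?thesis using le nlq by (metis order.not_eq_order_implies_strict)
  qed simp
  then show ?thesis by (rule that)
qed

text \<open>Hilbert's basis theorem in geometric form. Among the polynomials new at each stage of a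
  descent one with minimal leading monomial is chosen; by Dickson's lemma an earlier leading
  monomial divides a later one, and a division step contradicts minimality.\<close>

lemma wf_zariski_closed:
  "wf {(V, W :: 'k::field list set). zariski_closed n V \<and> zariski_closed n W \<and> V \<subset> W}"
  unfolding wf_iff_no_infinite_down_chain
proof (rule notI, elim exE)
  fix V :: "nat \<Rightarrow> 'k list set"
  assume V: "\<forall>i. (V (Suc i), V i) \<in> {(V, W). zariski_closed n V \<and> zariski_closed n W \<and> V \<subset> W}"
  define I where "I k = vanishing_ideal n (V k)" for k
  let ?lm = "\<lambda>p :: 'k mpoly. Max (Poly_Mapping.keys p)"
  have I0: "0 \<in> I k" for k
    using subring_setD(1)[OF subring_set_mpoly_ring] by (simp add: I_def vanishing_ideal_def mpoly_eval_0)
  have lm: "Poly_Mapping.keys (?lm p) \<subseteq> {..<n}" if "p \<in> I j - I k" for p j k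
  proof -
    have "p \<noteq> 0" using that I0 by auto
    then have "?lm p \<in> Poly_Mapping.keys p" by (intro Max_in) auto
    then show ?thesis using that by (auto simp: I_def vanishing_ideal_def mpoly_ring_def)
  qed
  have "\<exists>p. p \<in> I (Suc k) - I k \<and> (\<forall>q\<in>I (Suc k) - I k. \<not> ?lm q < ?lm p)" for k
  proof -
    have "V (Suc k) \<noteq> V k" "zariski_closed n (V k)" "zariski_closed n (V (Suc k))" using V by auto
    then have "I (Suc k) \<noteq> I k" unfolding I_def using zariski_closed_iff by metis
    moreover have "I k \<subseteq> I (Suc k)" unfolding I_def using V by (intro vanishing_ideal_antimono) auto
    ultimately obtain p where p: "p \<in> I (Suc k) - I k" by auto
    then have "?lm p \<in> ?lm ` (I (Suc k) - I k)" by blast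
    from wfE_min[OF wf_monomials[of n] this] obtain z where
      z: "z \<in> ?lm ` (I (Suc k) - I k)"
        "\<And>y. (y, z) \<in> {(m, m'). m < m' \<and> Poly_Mapping.keys m \<subseteq> {..<n} \<and> Poly_Mapping.keys m' \<subseteq> {..<n}} \<Longrightarrow>
             y \<notin> ?lm ` (I (Suc k) - I k)" by blast
    from z(1) obtain q where q: "q \<in> I (Suc k) - I k" "z = ?lm q" by blast
    have "\<not> ?lm q' < ?lm q" if "q' \<in> I (Suc k) - I k" for q'
      using z(2)[of "?lm q'"] q that lm by blast
    with q show ?thesis by blast
  qed
  then obtain f where f: "\<And>k. f k \<in> I (Suc k) - I k" "\<And>k q. q \<in> I (Suc k) - I k \<Longrightarrow> \<not> ?lm q < ?lm (f k)"
    by metis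
  have "Poly_Mapping.keys (?lm (f k)) \<subseteq> {..<n}" for k using lm[OF f(1)] .
  then obtain i j d where ij: "i < j" "?lm (f j) = ?lm (f i) + d" "Poly_Mapping.keys d \<subseteq> {..<n}"
    by (rule dickson)
  have nz: "f k \<noteq> 0" for k using f(1)[of k] I0 by auto
  obtain c where c: "f j - Poly_Mapping.single d c * f i = 0 \<or>
    ?lm (f j - Poly_Mapping.single d c * f i) < ?lm (f j)"
    using leading_monomial_reduce[OF nz nz ij(2)] by blast
  define g where "g = f j - Poly_Mapping.single d c * f i"
  have ring: "f k \<in> mpoly_ring n" for k using f(1)[of k] by (auto simp: I_def vanishing_ideal_def)
  have gr: "g \<in> mpoly_ring n"
    unfolding g_def using ij(3) by (intro mpoly_ring_diff ring mpoly_ring_mult mpoly_ring_single)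
  have "V (Suc k) \<subseteq> V k" for k using V by auto
  then have sub: "V k \<subseteq> V l" if "l \<le> k" for k l
    by (rule lift_Suc_antimono_le[OF _ that])
  \<comment> \<open>Since \<open>Suc i \<le> j\<close>, \<open>f i\<close> already vanishes on
    \<open>V j\<close>; subtracting its multiple changes no value there, so \<open>g\<close> is
    again new at stage \<open>j\<close>.\<close>
  have fi: "mpoly_value (f i) v = 0" if "v \<in> V j" for v
    using f(1)[of i] sub[of "Suc i" j] ij(1) that by (auto simp: I_def vanishing_ideal_def)
  have g_val: "mpoly_value g v = mpoly_value (f j) v" if "v \<in> V j" for v
    using fi[OF that] by (simp add: g_def mpoly_eval_diff[OF hom_on_id] mpoly_eval_mult[OF hom_on_id])
  have "g \<in> I (Suc j) - I j"
    using f(1)[of j] gr sub[of j "Suc j"] by (auto simp: I_def vanishing_ideal_def g_val subset_iff)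
  moreover from this have "g \<noteq> 0" using I0 by auto
  ultimately show False using f(2)[of g j] c by (auto simp: g_def)
qed

text \<open>Noetherian induction: a reducible \<open>V\<close> splits into two strictly smaller
  closed sets. The family may be redundant, so its members need not be components.\<close>

lemma zariski_closed_decomposition:
  assumes "zariski_closed n V"
  shows "\<exists>F. finite F \<and> (\<forall>W\<in>F. affine_variety n W) \<and> V = \<Union>F"
  using assms
proof (induction V rule: wf_induct_rule[OF wf_zariski_closed[of n]])
  case (1 V)
  show ?case
  proof (cases "V = {} \<or> affine_variety n V")
    case True
    then show ?thesis
    proof
      assume "affine_variety n V"
      then show ?thesis by (intro exI[of _ "{V}"]) auto
    qed (auto intro: exI[of _ "{}"])
  next
    case False
    then obtain A B where AB: "zariski_closed n A" "zariski_closed n B" "V \<subseteq> A \<union> B" "\<not> V \<subseteq> A" "\<not> V \<subseteq> B"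
      using 1(2) by (auto simp: affine_variety_def)
    have "\<exists>F. finite F \<and> (\<forall>W\<in>F. affine_variety n W) \<and> V \<inter> A = \<Union>F"
      using AB zariski_closed_Int[OF 1(2) AB(1)] 1(2) by (intro 1(1)) auto
    then obtain F where F: "finite F" "\<forall>W\<in>F. affine_variety n W" "V \<inter> A = \<Union>F" by blast
    have "\<exists>F. finite F \<and> (\<forall>W\<in>F. affine_variety n W) \<and> V \<inter> B = \<Union>F"
      using AB zariski_closed_Int[OF 1(2) AB(2)] 1(2) by (intro 1(1)) auto
    then obtain G where G: "finite G" "\<forall>W\<in>G. affine_variety n W" "V \<inter> B = \<Union>G" by blast
    have "V = (V \<inter> A) \<union> (V \<inter> B)" using AB(3) by auto
    then have "V = \<Union>(F \<union> G)" unfolding F(3) G(3) by auto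
    then show ?thesis using F G by (intro exI[of _ "F \<union> G"]) auto
  qed
qed

text \<open>The two-sided conclusion is invariant under complement, which carries the induction; for
  unions the two polynomials are multiplied, harmless by primality.\<close>

lemma constructible_generic_dichotomy:
  assumes W: "affine_variety n W" and "constructible n Z"
  shows "\<exists>f\<in>mpoly_ring n. f \<notin> vanishing_ideal n W \<and>
    ((\<forall>v\<in>W. mpoly_value f v \<noteq> 0 \<longrightarrow> v \<in> Z) \<or> (\<forall>v\<in>W. mpoly_value f v \<noteq> 0 \<longrightarrow> v \<notin> Z))"
  using assms(2)
proof (induction rule: constructible.induct)
  case (closed V)
  have Wn: "W \<subseteq> affine_space n" "W \<noteq> {}" using W by (auto simp: affine_variety_def dest: zariski_closed_subset)
  show ?case
  proof (cases "W \<subseteq> V")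
    case True
    have "(1 :: 'a mpoly) \<in> mpoly_ring n" using subring_setD(2)[OF subring_set_mpoly_ring] .
    moreover have "1 \<notin> vanishing_ideal n W"
      using Wn(2) by (auto simp: vanishing_ideal_def mpoly_eval_1[OF hom_on_id])
    ultimately show ?thesis using True by blast
  next
    case False
    then obtain w where w: "w \<in> W" "w \<notin> V" by auto
    obtain p where "p \<in> vanishing_ideal n V" "mpoly_value p w \<noteq> 0"
      using zariski_closed_separate[OF closed _ w(2)] w(1) Wn(1) by blast
    then show ?thesis using w by (intro bexI[of _ p]) (auto simp: vanishing_ideal_def)
  qed
next
  case (compl Y)
  have "W \<subseteq> affine_space n" using W by (auto simp: affine_variety_def dest: zariski_closed_subset)
  with compl.IH show ?case by blast
next
  case (union Y Z)
  from union.IH obtain f g where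
    fg: "f \<in> mpoly_ring n" "f \<notin> vanishing_ideal n W" "g \<in> mpoly_ring n" "g \<notin> vanishing_ideal n W"
    and f: "(\<forall>v\<in>W. mpoly_value f v \<noteq> 0 \<longrightarrow> v \<in> Y) \<or> (\<forall>v\<in>W. mpoly_value f v \<noteq> 0 \<longrightarrow> v \<notin> Y)"
    and g: "(\<forall>v\<in>W. mpoly_value g v \<noteq> 0 \<longrightarrow> v \<in> Z) \<or> (\<forall>v\<in>W. mpoly_value g v \<noteq> 0 \<longrightarrow> v \<notin> Z)"
    by blast
  have "f * g \<in> mpoly_ring n" "f * g \<notin> vanishing_ideal n W"
    using fg mpoly_ring_mult affine_variety_mult_nonvanishing[OF W] by auto
  then show ?case
    using f g by (intro bexI[of _ "f * g"]) (auto simp: mpoly_eval_mult[OF hom_on_id])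
qed

text \<open>Finiteness of the number of components is needed here: only then is the union of the
  other components a closed set not containing \<open>W\<close>.\<close>

lemma constructible_contains_open_of_component:
  assumes Y: "constructible n Y" and W: "irreducible_component n W (zariski_closure n Y)"
  shows "\<exists>f\<in>mpoly_ring n. f \<notin> vanishing_ideal n W \<and> (\<forall>v\<in>W. mpoly_value f v \<noteq> 0 \<longrightarrow> v \<in> Y)"
proof -
  let ?Z = "zariski_closure n Y"
  have Wv: "affine_variety n W" "W \<subseteq> ?Z"
    and Wmax: "\<And>W'. affine_variety n W' \<Longrightarrow> W \<subseteq> W' \<Longrightarrow> W' \<subseteq> ?Z \<Longrightarrow> W' = W"
    using W by (auto simp: irreducible_component_def)
  obtain f where f: "f \<in> mpoly_ring n" "f \<notin> vanishing_ideal n W"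
    "(\<forall>v\<in>W. mpoly_value f v \<noteq> 0 \<longrightarrow> v \<in> Y) \<or> (\<forall>v\<in>W. mpoly_value f v \<noteq> 0 \<longrightarrow> v \<notin> Y)"
    using constructible_generic_dichotomy[OF Wv(1) Y] by blast
  \<comment> \<open>Otherwise \<open>Y\<close>, and with it its closure, lies in the union of the
    hypersurface of \<open>f\<close> and the pieces other than \<open>W\<close>. Irreducibility puts
    \<open>W\<close> into one of these, against the choice of \<open>f\<close> or the maximality of
    \<open>W\<close>.\<close>
  have False if disj: "\<forall>v\<in>W. mpoly_value f v \<noteq> 0 \<longrightarrow> v \<notin> Y"
  proof -
    have Yn: "Y \<subseteq> affine_space n" using constructible_subset[OF Y] .
    obtain F where F: "finite F" "\<forall>V\<in>F. affine_variety n V" "?Z = \<Union>F"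
      using zariski_closed_decomposition[OF zariski_closure_closed[OF Yn]] by blast
    let ?H = "{a \<in> affine_space n. mpoly_value f a = 0}"
    let ?F = "insert ?H (F - {W})"
    have closed: "zariski_closed n V" if "V \<in> ?F" for V
      using that F(2) zariski_closed_hypersurface[OF f(1)] by (auto simp: affine_variety_def)
    have "y \<in> \<Union>?F" if y: "y \<in> Y" for y
    proof -
      obtain V where "V \<in> F" "y \<in> V" using zariski_closure_superset[of Y n] F(3) y by auto
      then show ?thesis using disj Yn y by (cases "V = W") auto
    qed
    then have "Y \<subseteq> \<Union>?F" by blast
    then have "?Z \<subseteq> \<Union>?F"
      using zariski_closed_Union[of ?F n] closed F(1) by (intro zariski_closure_least) auto
    then have "W \<subseteq> \<Union>?F" using Wv(2) by blast
    then obtain V where V: "V \<in> ?F" "W \<subseteq> V"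
      using affine_variety_subset_Union[OF Wv(1), of ?F] closed F(1) by blast
    then consider "W \<subseteq> ?H" | "V \<in> F" "V \<noteq> W" by auto
    then show False
    proof cases
      case 1
      then show False using f(1,2) by (auto simp: vanishing_ideal_def)
    next
      case 2
      then show False using Wmax[of V] V(2) F(2,3) by auto
    qed
  qed
  then show ?thesis using f by blast
qed


section \<open>Multiplicative independence over the constants\<close>

lemma multiplicative_power_int:
  fixes h :: "'a::field \<Rightarrow> 'b::field"
  assumes m: "\<And>x y. h (x * y) = h x * h y" and 1: "h 1 = 1" and 0: "h 0 = 0"
  shows "h (x powi k) = h x powi k"
proof -
  have pow: "h (y ^ n) = h y ^ n" for y n by (induction n) (simp_all add: m 1)
  have "h (inverse x) = inverse (h x)"
  proof (cases "x = 0")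
    case False
    then have "h x * h (inverse x) = 1" by (simp add: 1 flip: m)
    then show ?thesis by (metis inverse_unique)
  qed (simp add: 0)
  then show ?thesis by (simp add: power_int_def pow)
qed

lemma univ_emb_power_int: "univ_emb (c powi k) = univ_emb c powi k"
  by (rule multiplicative_power_int) (simp_all add: univ_emb_hom)

lemma univ_emb_eq_0_iff: "univ_emb c = 0 \<longleftrightarrow> c = 0"
  by (rule field_hom_eq_0_iff[OF hom_on_univ_emb])

lemma univ_emb_prod: "univ_emb (\<Prod>i\<in>I. f i) = (\<Prod>i\<in>I. univ_emb (f i))"
  by (rule hom_on_prod[OF subring_set_UNIV hom_on_univ_emb]) simp

lemma power_int_mult_power:
  fixes x :: "'a::field"
  shows "x \<noteq> 0 \<Longrightarrow> x powi k * x ^ nat (- k) = x ^ nat k"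
  by (cases "k \<ge> 0") (auto simp: power_int_def power_inverse)

text \<open>Clears negative exponents, so that Laurent relations become polynomial ones.\<close>

lemma prod_power_int_mult_power:
  fixes x :: "'i \<Rightarrow> 'a::field"
  assumes "\<And>i. i \<in> I \<Longrightarrow> x i \<noteq> 0"
  shows "(\<Prod>i\<in>I. x i powi k i) * (\<Prod>i\<in>I. x i ^ nat (- k i)) = (\<Prod>i\<in>I. x i ^ nat (k i))"
  using assms by (simp add: power_int_mult_power flip: prod.distrib)

lemma prod_power_int_right:
  fixes f :: "'i \<Rightarrow> 'a::field"
  shows "(\<Prod>i\<in>I. f i) powi k = (\<Prod>i\<in>I. f i powi k)"
  by (induction I rule: infinite_finite_induct) (simp_all add: power_int_mult_distrib)

lemma power_int_sum:
  fixes x :: "'a::field"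
  assumes "x \<noteq> 0"
  shows "x powi (\<Sum>i\<in>I. k i) = (\<Prod>i\<in>I. x powi k i)"
  by (induction I rule: infinite_finite_induct) (simp_all add: power_int_add assms)

text \<open>Elimination without division: cross-multiplication with a pivot row \<open>p\<close>
  clears column \<open>n\<close>, leaving one vector and one coordinate fewer.\<close>

lemma int_vectors_dependent:
  fixes M :: "'j \<Rightarrow> nat \<Rightarrow> int"
  assumes "finite J" "n < card J"
  shows "\<exists>s. (\<exists>j\<in>J. s j \<noteq> 0) \<and> (\<forall>i<n. (\<Sum>j\<in>J. s j * M j i) = 0)"
  using assms
proof (induction n arbitrary: J M)
  case 0
  then have "J \<noteq> {}" by auto
  then show ?case by (intro exI[of _ "\<lambda>_. 1"]) auto
next
  case (Suc n)
  show ?case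
  proof (cases "\<exists>p\<in>J. M p n \<noteq> 0")
    case False
    obtain s where "\<exists>j\<in>J. s j \<noteq> 0" "\<forall>i<n. (\<Sum>j\<in>J. s j * M j i) = 0"
      using Suc.IH[OF Suc.prems(1), of M] Suc.prems(2) by auto
    then show ?thesis using False by (intro exI[of _ s]) (auto simp: less_Suc_eq)
  next
    case True
    then obtain p where p: "p \<in> J" "M p n \<noteq> 0" by blast
    let ?J = "J - {p}"
    have J: "finite ?J" "n < card ?J" using Suc.prems p by auto
    from Suc.IH[OF J, of "\<lambda>j i. M p n * M j i - M j n * M p i"] obtain s where
      s: "\<exists>j\<in>?J. s j \<noteq> 0" "\<And>i. i < n \<Longrightarrow> (\<Sum>j\<in>?J. s j * (M p n * M j i - M j n * M p i)) = 0"
      by blast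
    \<comment> \<open>Undoes the elimination: the other rows pick up the factor
      \<open>M p n\<close>, and the pivot collects the subtracted multiples.\<close>
    define t where "t = (\<lambda>j. if j = p then - (\<Sum>j\<in>?J. s j * M j n) else M p n * s j)"
    have t: "(\<Sum>j\<in>J. t j * M j i) = (\<Sum>j\<in>?J. s j * (M p n * M j i - M j n * M p i))" for i
    proof -
      have "(\<Sum>j\<in>J. t j * M j i) = t p * M p i + (\<Sum>j\<in>?J. t j * M j i)"
        using Suc.prems(1) p(1) by (rule sum.remove)
      also have "(\<Sum>j\<in>?J. t j * M j i) = (\<Sum>j\<in>?J. s j * (M p n * M j i))"
        by (intro sum.cong) (auto simp: t_def)
      finally show ?thesis
        by (simp add: t_def right_diff_distrib sum_subtractf sum_distrib_right mult.assoc)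
    qed
    have "(\<Sum>j\<in>J. t j * M j i) = 0" if "i < Suc n" for i
      using that s(2) unfolding t by (cases "i = n") (simp_all add: mult.commute)
    moreover have "\<exists>j\<in>J. t j \<noteq> 0" using s(1) p(2) by (auto simp: t_def)
    ultimately show ?thesis by blast
  qed
qed

definition mult_indep :: "'k::field univ_dom list \<Rightarrow> bool" where
  "mult_indep x \<longleftrightarrow> 0 \<notin> set x \<and>
     (\<forall>l :: nat \<Rightarrow> int. (\<Prod>i<length x. (x ! i) powi l i) \<in> univ_emb ` (- {0}) \<longrightarrow> (\<forall>i<length x. l i = 0))"

lemma mult_indepD:
  assumes "mult_indep x" "(\<Prod>i<length x. (x ! i) powi l i) = univ_emb c" "c \<noteq> 0" "i < length x"
  shows "l i = 0"
  using assms unfolding mult_indep_def by blast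

lemma mult_indep_nonzero: "mult_indep x \<Longrightarrow> i < length x \<Longrightarrow> x ! i \<noteq> 0"
  unfolding mult_indep_def by (metis nth_mem)

text \<open>The relation must involve \<open>e\<close>, since otherwise it would be a relation of
  \<open>x\<close>.\<close>

lemma not_mult_indep_snoc:
  assumes x: "mult_indep x" and e: "e \<noteq> 0" and n: "\<not> mult_indep (x @ [e])"
  obtains l k c where "k \<noteq> 0" "c \<noteq> 0" "(\<Prod>i<length x. (x ! i) powi l i) * e powi k = univ_emb c"
proof -
  have "0 \<notin> set (x @ [e])" using x e by (auto simp: mult_indep_def)
  with n obtain l c i where l: "(\<Prod>i<Suc (length x). ((x @ [e]) ! i) powi l i) = univ_emb c" "c \<noteq> 0"
    "i < Suc (length x)" "l i \<noteq> 0"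
    by (auto simp: mult_indep_def)
  then have eq: "(\<Prod>i<length x. (x ! i) powi l i) * e powi l (length x) = univ_emb c"
    by (simp add: nth_append)
  have "l (length x) \<noteq> 0"
  proof
    assume 0: "l (length x) = 0"
    then have "i < length x" using l(3,4) by (metis less_antisym)
    then show False using mult_indepD[OF x _ l(2)] eq 0 l(4) by auto
  qed
  then show ?thesis using that eq l(2) by blast
qed

section \<open>Independence of the variables of the universal domain\<close>

definition mpoly_emb :: "'k::field mpoly \<Rightarrow> 'k univ_dom" where
  "mpoly_emb p = to_ac (Fract p 1)"

lemma mpoly_emb_eq_iff: "mpoly_emb p = mpoly_emb q \<longleftrightarrow> p = q"
  by (simp add: mpoly_emb_def eq_fract)

lemma mpoly_emb_mult: "mpoly_emb p * mpoly_emb q = mpoly_emb (p * q)"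
  by (simp add: mpoly_emb_def flip: to_ac_mult)

lemma mpoly_emb_1: "mpoly_emb 1 = 1"
  by (simp add: mpoly_emb_def flip: One_fract_def)

lemma univ_emb_eq_mpoly_emb: "univ_emb c = mpoly_emb (Poly_Mapping.single 0 c)"
  by (simp add: univ_emb_def mpoly_emb_def)

definition univ_var :: "nat \<Rightarrow> 'k::field univ_dom" where
  "univ_var j = mpoly_emb (Poly_Mapping.single (Poly_Mapping.single j 1) 1)"

lemma prod_univ_var_power:
  assumes "finite J"
  shows "(\<Prod>j\<in>J. univ_var j ^ k j :: 'k::field univ_dom) =
    mpoly_emb (Poly_Mapping.single (\<Sum>j\<in>J. Poly_Mapping.single j (k j)) 1)"
proof -
  have pw: "univ_var j ^ m = (mpoly_emb (Poly_Mapping.single (Poly_Mapping.single j m) 1) :: 'k univ_dom)" for j m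
  proof (induction m)
    case (Suc m)
    then show ?case by (simp add: univ_var_def mpoly_emb_mult mult_single flip: single_add)
  qed (simp add: mpoly_emb_1)
  show ?thesis
    using assms by (induction J rule: finite_induct) (simp_all add: pw mpoly_emb_1 mpoly_emb_mult mult_single)
qed

lemma univ_var_nonzero: "univ_var j \<noteq> (0 :: 'k::field univ_dom)"
proof -
  have "(0 :: 'k univ_dom) = mpoly_emb 0" by (simp add: mpoly_emb_def flip: Zero_fract_def)
  moreover have "Poly_Mapping.single (Poly_Mapping.single j 1) (1::'k) \<noteq> 0"
    by (metis lookup_single_eq lookup_zero zero_neq_one)
  ultimately show ?thesis by (metis mpoly_emb_eq_iff univ_var_def)
qed

text \<open>Once negative exponents are cleared, both sides are single terms; comparing exponents
  gives \<open>nat (e j) = nat (- e j)\<close>.\<close>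

lemma univ_var_mult_indep:
  fixes c :: "'k::field"
  assumes J: "finite J" and eq: "(\<Prod>j\<in>J. univ_var j powi e j) = univ_emb c" and j: "j \<in> J"
  shows "e j = 0"
proof -
  let ?m = "\<lambda>k. \<Sum>j\<in>J. Poly_Mapping.single j (k j :: nat)"
  let ?p = "\<lambda>j. nat (e j)" and ?q = "\<lambda>j. nat (- e j)"
  have "univ_emb c * (\<Prod>j\<in>J. univ_var j ^ nat (- e j)) = (\<Prod>j\<in>J. univ_var j ^ nat (e j))"
    unfolding eq[symmetric] by (rule prod_power_int_mult_power) (simp add: univ_var_nonzero)
  then have eq': "Poly_Mapping.single (?m ?q) c = Poly_Mapping.single (?m ?p) 1"
    by (simp add: prod_univ_var_power[OF J] univ_emb_eq_mpoly_emb mpoly_emb_mult mpoly_emb_eq_iff mult_single)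
  have "?m ?p \<in> Poly_Mapping.keys (Poly_Mapping.single (?m ?q) c)"
    unfolding eq' by simp
  then have mm: "?m ?p = ?m ?q" by (auto split: if_splits)
  have lk: "Poly_Mapping.lookup (?m k) j = k j" for k
    using J j by (simp add: lookup_sum lookup_single when_def)
  have "nat (e j) = nat (- e j)" using lk[of ?p] lk[of ?q] mm by simp
  then show ?thesis by linarith
qed

text \<open>Modulo torsion, the multiplicative group of the universal domain over the constants has
  infinite rank, since the variables are independent in it.\<close>

lemma mult_indep_extend1:
  fixes x :: "'k::field univ_dom list"
  assumes x: "mult_indep x"
  shows "\<exists>e. mult_indep (x @ [e])"
proof (rule ccontr)
  assume no: "\<not> ?thesis"
  let ?n = "length x"
  have "\<exists>l k c. k \<noteq> 0 \<and> c \<noteq> 0 \<and> (\<Prod>i<?n. (x ! i) powi l i) * univ_var j powi k = univ_emb c" for j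
    by (rule not_mult_indep_snoc[OF x univ_var_nonzero, of j]) (use no in blast)+
  then have "\<exists>l. \<forall>j. \<exists>k c. k \<noteq> 0 \<and> c \<noteq> 0 \<and>
      (\<Prod>i<?n. (x ! i) powi l j i) * univ_var j powi k = univ_emb c"
    by (intro choice allI)
  then obtain l where "\<forall>j. \<exists>k c. k \<noteq> 0 \<and> c \<noteq> 0 \<and>
      (\<Prod>i<?n. (x ! i) powi l j i) * univ_var j powi k = univ_emb c" by blast
  from choice[OF this] obtain k where "\<forall>j. \<exists>c. k j \<noteq> 0 \<and> c \<noteq> 0 \<and>
      (\<Prod>i<?n. (x ! i) powi l j i) * univ_var j powi k j = univ_emb c" by blast
  from choice[OF this] obtain c where lkc: "\<And>j. k j \<noteq> 0" "\<And>j. c j \<noteq> 0"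
    "\<And>j. (\<Prod>i<?n. (x ! i) powi l j i) * univ_var j powi k j = univ_emb (c j)" by blast
  \<comment> \<open>The \<open>?n + 1\<close> variables have relations with only \<open>?n\<close>
    exponents on \<open>x\<close>; the weights \<open>s\<close> cancel \<open>x\<close> and leave a
    forbidden relation between variables alone.\<close>
  obtain s where s: "\<exists>j\<in>{..?n}. s j \<noteq> 0" "\<forall>i<?n. (\<Sum>j\<le>?n. s j * l j i) = 0"
    using int_vectors_dependent[of "{..?n}" ?n l] by auto
  have "(\<Prod>j\<le>?n. univ_emb (c j) powi s j) =
      (\<Prod>j\<le>?n. \<Prod>i<?n. (x ! i) powi (s j * l j i)) * (\<Prod>j\<le>?n. univ_var j powi (s j * k j))"
    by (simp add: lkc(3)[symmetric] power_int_mult_distrib prod_power_int_right prod.distrib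
        mult.commute[of "s _"] flip: power_int_mult)
  also have "(\<Prod>j\<le>?n. \<Prod>i<?n. (x ! i) powi (s j * l j i)) = (\<Prod>i<?n. (x ! i) powi (\<Sum>j\<le>?n. s j * l j i))"
    by (subst prod.swap) (simp add: power_int_sum mult_indep_nonzero[OF x])
  also have "\<dots> = 1" using s(2) by simp
  finally have "(\<Prod>j\<le>?n. univ_var j powi (s j * k j)) = univ_emb (\<Prod>j\<le>?n. c j powi s j)"
    by (simp add: univ_emb_prod univ_emb_power_int)
  then have "s j * k j = 0" if "j \<le> ?n" for j
    using univ_var_mult_indep[of "{..?n}" "\<lambda>j. s j * k j"] that by auto
  then show False using s(1) lkc(1) by auto
qed

lemma mult_indep_extend:
  fixes x :: "'k::field univ_dom list"
  assumes "mult_indep x"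
  shows "\<exists>y. length y = m \<and> mult_indep (x @ y)"
proof (induction m)
  case (Suc m)
  then obtain y where y: "length y = m" "mult_indep (x @ y)" by blast
  from mult_indep_extend1[OF y(2)] obtain e where "mult_indep (x @ y @ [e])" by auto
  then show ?case using y(1) by (intro exI[of _ "y @ [e]"]) simp
qed (simp add: assms)


section \<open>Specialisation to graphs\<close>

text \<open>Both tuples are kept in the torus so that Laurent relations, too, pass from
  \<open>z\<close> to \<open>w\<close>.\<close>

definition specialises :: "'k::field univ_dom list \<Rightarrow> 'k list \<Rightarrow> bool" where
  "specialises z w \<longleftrightarrow> length w = length z \<and> 0 \<notin> set z \<and> 0 \<notin> set w \<and>
     (\<forall>p\<in>mpoly_ring (length z). mpoly_eval univ_emb p z = 0 \<longrightarrow> mpoly_value p w = 0)"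

definition mpoly_var :: "nat \<Rightarrow> 'k::field mpoly" where
  "mpoly_var i = Poly_Mapping.single (Poly_Mapping.single i 1) 1"

lemma monom_eval_single: "monom_eval (Poly_Mapping.single i k) a = (a ! i) ^ k"
  by (simp add: monom_eval_def)

lemma mpoly_eval_var:
  fixes h :: "'k::field \<Rightarrow> 'l::comm_ring_1"
  shows "hom_on UNIV h \<Longrightarrow> mpoly_eval h (mpoly_var i) a = a ! i"
  by (simp add: mpoly_var_def mpoly_eval_single monom_eval_single hom_onD(1,2))

lemma mpoly_ring_var: "i < n \<Longrightarrow> mpoly_var i \<in> mpoly_ring n"
  unfolding mpoly_var_def by (rule mpoly_ring_single) simp

lemma monom_eval_sum_single:
  "monom_eval (\<Sum>j\<in>J. Poly_Mapping.single (\<sigma> j) (k j)) a = (\<Prod>j\<in>J. (a ! \<sigma> j) ^ k j)"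
  by (induction J rule: infinite_finite_induct) (simp_all add: monom_eval_0 monom_eval_add monom_eval_single)

text \<open>In \<open>?p\<close> the negative exponents are moved to the other side; at
  \<open>w\<close> the moved monomial is nonzero and can be cancelled again.\<close>

lemma specialises_laurent:
  fixes f :: "'k::field mpoly"
  assumes zw: "specialises z w" and f: "f \<in> mpoly_ring (length z)"
    and \<sigma>: "finite J" "\<And>j. j \<in> J \<Longrightarrow> \<sigma> j < length z"
    and eq: "mpoly_eval univ_emb f z ^ m * (\<Prod>j\<in>J. (z ! \<sigma> j) powi l j) = univ_emb c"
  shows "mpoly_value f w ^ m * (\<Prod>j\<in>J. (w ! \<sigma> j) powi l j) = c"
proof -
  let ?M = "\<lambda>k. \<Sum>j\<in>J. Poly_Mapping.single (\<sigma> j) (k j :: nat)"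
  let ?p = "f ^ m * Poly_Mapping.single (?M (\<lambda>j. nat (l j))) 1 - Poly_Mapping.single (?M (\<lambda>j. nat (- l j))) c"
  have ev: "mpoly_eval h ?p a =
      mpoly_eval h f a ^ m * (\<Prod>j\<in>J. (a ! \<sigma> j) ^ nat (l j)) - h c * (\<Prod>j\<in>J. (a ! \<sigma> j) ^ nat (- l j))"
    if "hom_on UNIV h" for h :: "'k \<Rightarrow> 'l::comm_ring_1" and a
    using that
    by (simp add: mpoly_eval_diff mpoly_eval_mult mpoly_eval_power mpoly_eval_single hom_onD(1,2) monom_eval_sum_single)
  have nz: "z ! \<sigma> j \<noteq> 0" "w ! \<sigma> j \<noteq> 0" if "j \<in> J" for j
    using zw \<sigma>(2)[OF that] unfolding specialises_def by (metis nth_mem)+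
  have "Poly_Mapping.keys (?M k) \<subseteq> {..<length z}" for k
    using keys_sum[of "\<lambda>j. Poly_Mapping.single (\<sigma> j) (k j)" J] \<sigma>(2) by (fastforce split: if_splits)
  then have p: "?p \<in> mpoly_ring (length z)"
    using f subring_set_power[OF subring_set_mpoly_ring]
    by (intro mpoly_ring_diff mpoly_ring_mult mpoly_ring_single) auto
  have "mpoly_eval univ_emb f z ^ m * (\<Prod>j\<in>J. (z ! \<sigma> j) ^ nat (l j)) =
      univ_emb c * (\<Prod>j\<in>J. (z ! \<sigma> j) ^ nat (- l j))"
    unfolding eq[symmetric] using nz(1) by (simp add: mult.assoc prod_power_int_mult_power)
  then have "mpoly_eval univ_emb ?p z = 0" by (simp add: ev[OF hom_on_univ_emb])
  then have "mpoly_value ?p w = 0" using zw p by (auto simp: specialises_def)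
  then have "mpoly_value f w ^ m * (\<Prod>j\<in>J. (w ! \<sigma> j) ^ nat (l j)) = c * (\<Prod>j\<in>J. (w ! \<sigma> j) ^ nat (- l j))"
    by (simp add: ev[OF hom_on_id])
  moreover have "(\<Prod>j\<in>J. (w ! \<sigma> j) ^ nat (l j)) =
      (\<Prod>j\<in>J. (w ! \<sigma> j) powi l j) * (\<Prod>j\<in>J. (w ! \<sigma> j) ^ nat (- l j))"
    using nz(2) by (simp add: prod_power_int_mult_power)
  moreover have "(\<Prod>j\<in>J. (w ! \<sigma> j) ^ nat (- l j)) \<noteq> 0" using nz(2) \<sigma>(1) by simp
  ultimately show ?thesis by (simp flip: mult.assoc)
qed

text \<open>The axioms of ACFH speak of closed subsets of affine space inside the torus; these
  arise from subvarieties of the torus by taking the \<open>y\<close>-variables to be the inverses of the \<open>x\<close>-variables.\<close>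

definition inverse_system :: "nat list \<Rightarrow> 'k::field min_eq" where
  "inverse_system k = Min_Eq 1 1 (map (\<lambda>j. - int j) k)"

lemma complete_system_inverse: "complete_system r (replicate r 1) inverse_system"
  by (simp add: complete_system_def inverse_system_def sys_index_def)

lemma sys_solutions_inverse:
  assumes u: "length u = 2 * r" "\<And>i. i < r \<Longrightarrow> u ! i * u ! (r + i) = 1"
  shows "u \<in> sys_solutions r (replicate r 1) inverse_system"
proof -
  let ?x = "take r u" and ?y = "drop r u"
  have xy: "?x ! i * ?y ! i = 1" if "i < r" for i using u that by simp
  then have nz: "?x ! i \<noteq> 0" "?y ! i \<noteq> 0" if "i < r" for i using that by fastforce+
  have "(\<Prod>i<r. ?y ! i ^ (k ! i)) = (\<Prod>i<r. ?x ! i powi (map (\<lambda>j. - int j) k ! i))"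
    if "length k = r" for k
  proof (rule prod.cong)
    fix i assume i: "i \<in> {..<r}"
    then have "?y ! i = inverse (?x ! i)" using xy[of i] by (metis inverse_unique lessThan_iff)
    then show "?y ! i ^ (k ! i) = ?x ! i powi (map (\<lambda>j. - int j) k ! i)"
      using i that by (simp add: power_int_minus power_inverse)
  qed simp
  moreover have "0 \<notin> set ?x" "0 \<notin> set ?y"
    using nz u(1) by (auto simp: in_set_conv_nth)
  ultimately show ?thesis
    unfolding sys_solutions_def using u(1)
    by (intro CollectI exI[of _ ?x] exI[of _ ?y]) (auto simp: affine_space_def sys_index_def inverse_system_def)
qed

text \<open>The axiom is applied to the locus of the displayed tuple. It asks for freeness of the
  first \<open>r\<close> coordinates only, so \<open>x'\<close> may be any nonzero tuple.\<close>

lemma ACFH_specialisation: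
  fixes \<theta> :: "'k::alg_closed_field \<Rightarrow> 'k"
  assumes ACFH: "ACFH \<theta>" and x: "mult_indep x" and x': "length x' = length x" "0 \<notin> set x'"
  obtains \<alpha> \<beta> where "length \<alpha> = length x" "length \<beta> = length x"
    "specialises (x @ map inverse x @ x' @ map inverse x') (\<alpha> @ \<beta> @ map \<theta> \<alpha> @ map \<theta> \<beta>)"
proof -
  define r where "r = length x"
  define z where "z = x @ map inverse x @ x' @ map inverse x'"
  have len: "length z = 2 * r + 2 * r" using x' by (simp add: z_def r_def)
  have x0: "0 \<notin> set x" using x by (simp add: mult_indep_def)
  have z1: "z ! i * z ! (r + i) = 1" "z ! (2 * r + i) * z ! (3 * r + i) = 1" if "i < r" for i
  proof -
    have "x ! i \<noteq> 0" "x' ! i \<noteq> 0" using x0 x' that r_def by (metis nth_mem)+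
    then show "z ! i * z ! (r + i) = 1" "z ! (2 * r + i) * z ! (3 * r + i) = 1"
      using that x'(1) by (auto simp: z_def nth_append r_def)
  qed
  \<comment> \<open>Being mutually inverse is a polynomial relation of \<open>z\<close>, so it holds
    on the whole locus and forces it into the torus.\<close>
  have sol: "w ! i * w ! j = 1"
    if w: "w \<in> locus z" and ij: "i < length z" "j < length z" "z ! i * z ! j = 1" for w i j
  proof -
    let ?p = "mpoly_var i * mpoly_var j - 1"
    have p: "?p \<in> mpoly_ring (length z)"
      using ij by (intro mpoly_ring_diff mpoly_ring_mult mpoly_ring_var subring_setD(2)[OF subring_set_mpoly_ring])
    have ev: "mpoly_eval h ?p a = a ! i * a ! j - 1" if "hom_on UNIV h"
      for h :: "'k \<Rightarrow> 'l::comm_ring_1" and a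
      using that by (simp add: mpoly_eval_diff mpoly_eval_mult mpoly_eval_1 mpoly_eval_var)
    have "mpoly_eval univ_emb ?p z = 0" using ij by (simp add: ev[OF hom_on_univ_emb])
    then have "mpoly_value ?p w = 0" using w p by (auto simp: locus_def zero_set_def)
    then show ?thesis by (simp add: ev[OF hom_on_id])
  qed
  have \<theta>1: "\<theta> 1 = 1" using ACFH by (auto simp: ACFH_def multiplicative_map_def)
  \<comment> \<open>The constants of the system are all 1, so one system serves both halves.\<close>
  have twist: "sys_twist \<theta> inverse_system = inverse_system"
    by (rule ext) (simp add: sys_twist_def inverse_system_def \<theta>1)
  let ?S = "sys_solutions r (replicate r 1) (inverse_system :: nat list \<Rightarrow> 'k min_eq)"
  have sub: "locus z \<subseteq> {u @ v | u v. u \<in> ?S \<and> v \<in> sys_solutions r (replicate r 1) (sys_twist \<theta> inverse_system)}"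
  proof
    fix w assume w: "w \<in> locus z"
    then have lw: "length w = 4 * r" using len by (simp add: locus_def zero_set_def affine_space_def)
    have "take (2 * r) w \<in> ?S"
      using lw sol[OF w _ _ z1(1)] len by (intro sys_solutions_inverse) auto
    moreover have "drop (2 * r) w \<in> ?S"
      using lw sol[OF w _ _ z1(2)] len by (intro sys_solutions_inverse) (auto simp: algebra_simps)
    ultimately show "w \<in> {u @ v | u v. u \<in> ?S \<and> v \<in> sys_solutions r (replicate r 1) (sys_twist \<theta> inverse_system)}"
      unfolding twist by (intro CollectI exI[of _ "take (2 * r) w"] exI[of _ "drop (2 * r) w"]) simp
  qed
  have "mult_free (2 * r + 2 * r) r (locus z)"
    unfolding mult_free_def
  proof (intro exI[of _ z] conjI allI impI)
    show "generic_point (2 * r + 2 * r) (locus z) z" using generic_point_locus[of z] len by simp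
    have zx: "z ! i = x ! i" if "i < r" for i using that by (simp add: z_def nth_append r_def)
    show "z ! i \<noteq> 0" if "i < r" for i
      using zx[OF that] mult_indep_nonzero[OF x] that by (simp add: r_def)
    fix l :: "nat \<Rightarrow> int" and i
    assume "(\<Prod>i<r. z ! i powi l i) \<in> univ_emb ` (- {0})" and i: "i < r"
    then have "(\<Prod>i<r. x ! i powi l i) \<in> univ_emb ` (- {0})" by (simp add: zx)
    then show "l i = 0" using x i by (simp add: mult_indep_def r_def)
  qed
  moreover have "affine_variety (2 * r + 2 * r) (locus z)" using affine_variety_locus[of z] len by simp
  ultimately obtain \<alpha> \<beta> where \<alpha>\<beta>: "\<alpha> \<in> affine_space r" "\<beta> \<in> affine_space r"
      "\<alpha> @ \<beta> @ map \<theta> \<alpha> @ map \<theta> \<beta> \<in> locus z"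
    using ACFH complete_system_inverse[of r] sub length_replicate[of r 1] unfolding ACFH_def by blast
  let ?w = "\<alpha> @ \<beta> @ map \<theta> \<alpha> @ map \<theta> \<beta>"
  have "0 \<notin> set u" if "u \<in> ?S" for u using that by (auto simp: sys_solutions_def)
  moreover obtain u v where "?w = u @ v" "u \<in> ?S" "v \<in> ?S" using \<alpha>\<beta>(3) sub unfolding twist by blast
  ultimately have "0 \<notin> set ?w" by (metis Un_iff set_append)
  moreover have "0 \<notin> set z" using x0 x'(2) by (auto simp: z_def)
  ultimately have "specialises z ?w"
    using \<alpha>\<beta>(3) by (auto simp: specialises_def locus_def zero_set_def affine_space_def)
  then show ?thesis using that \<alpha>\<beta>(1,2) by (simp add: affine_space_def r_def z_def)
qed

lemma nonvanishing_coordinate: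
  fixes a :: "'k::alg_closed_field univ_dom list"
  assumes a: "mult_indep a" and f: "f \<in> mpoly_ring (length a)" "mpoly_eval univ_emb f a \<noteq> 0"
  obtains e where "mult_indep (a @ [e])"
    "\<And>z w. specialises z w \<Longrightarrow> length a < length z \<Longrightarrow> take (Suc (length a)) z = a @ [e] \<Longrightarrow> mpoly_value f w \<noteq> 0"
proof -
  let ?n = "length a" and ?fa = "mpoly_eval univ_emb f a"
  have za: "z ! i = (a @ [e]) ! i"
    if "take (Suc ?n) z = a @ [e]" "i < Suc ?n" for z :: "'k univ_dom list" and e i
    using that by (metis nth_take)
  have fz: "mpoly_eval univ_emb f z = ?fa" if "take (Suc ?n) z = a @ [e]" for z :: "'k univ_dom list" and e
    using za[OF that] by (intro mpoly_eval_cong[OF f(1)]) (auto simp: nth_append)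
  show ?thesis
  proof (cases "mult_indep (a @ [?fa])")
    case True
    show ?thesis
    proof (rule that[OF True])
      fix z :: "'k univ_dom list" and w
      assume zw: "specialises z w" and n: "?n < length z" and t: "take (Suc ?n) z = a @ [?fa]"
      \<comment> \<open>This relation passes to \<open>w\<close> and identifies the value of
        \<open>f\<close> there with a coordinate, which is nonzero.\<close>
      let ?p = "f - mpoly_var ?n"
      have ev: "mpoly_eval h ?p a = mpoly_eval h f a - a ! ?n" if "hom_on UNIV h"
        for h :: "'k \<Rightarrow> 'l::comm_ring_1" and a
        using that by (simp add: mpoly_eval_diff mpoly_eval_var)
      have "?p \<in> mpoly_ring (length z)"
        using f(1) n by (intro mpoly_ring_diff mpoly_ring_var) (auto intro: mpoly_ring_mono)
      moreover have "mpoly_eval univ_emb ?p z = 0" using fz[OF t] za[OF t, of ?n] by (simp add: ev[OF hom_on_univ_emb])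
      ultimately have "mpoly_value ?p w = 0" using zw by (auto simp: specialises_def)
      then have "mpoly_value f w = w ! ?n" by (simp add: ev[OF hom_on_id])
      then show "mpoly_value f w \<noteq> 0" using zw n unfolding specialises_def by (metis nth_mem)
    qed
  next
    case False
    obtain l k c where lkc: "k \<noteq> 0" "c \<noteq> 0" "(\<Prod>i<?n. (a ! i) powi l i) * ?fa powi k = univ_emb c"
      using not_mult_indep_snoc[OF a f(2) False] by blast
    \<comment> \<open>Raising the relation to the power \<open>sgn k\<close> makes the exponent of
      \<open>?fa\<close> positive, so that it becomes a power of the polynomial
      \<open>f\<close>.\<close>
    define s where "s = sgn k"
    define m where "m = nat \<bar>k\<bar>"
    have "univ_emb (c powi s) = (\<Prod>i<?n. (a ! i) powi (l i * s)) * ?fa powi (k * s)"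
      by (simp add: univ_emb_power_int power_int_mult_distrib prod_power_int_right power_int_mult flip: lkc(3))
    also have "k * s = int m" by (simp add: s_def m_def mult_sgn_abs abs_mult_sgn sgn_mult_abs flip: abs_sgn)
    finally have rel: "?fa ^ m * (\<Prod>i<?n. (a ! i) powi (l i * s)) = univ_emb (c powi s)"
      by (simp add: mult.commute)
    \<comment> \<open>Here \<open>e\<close> is a filler that keeps the same layout of coordinates in
      both cases; nonvanishing comes from \<open>rel\<close>.\<close>
    obtain e where e: "mult_indep (a @ [e])" using mult_indep_extend1[OF a] by blast
    show ?thesis
    proof (rule that[OF e])
      fix z :: "'k univ_dom list" and w
      assume zw: "specialises z w" and n: "?n < length z" and t: "take (Suc ?n) z = a @ [e]"
      have "(\<Prod>i<?n. (z ! i) powi (l i * s)) = (\<Prod>i<?n. (a ! i) powi (l i * s))"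
        using za[OF t] by (intro prod.cong) (auto simp: nth_append)
      then have "mpoly_value f w ^ m * (\<Prod>i<?n. (w ! i) powi (l i * s)) = c powi s"
        using n rel f(1) by (intro specialises_laurent[OF zw]) (auto simp: fz[OF t] intro: mpoly_ring_mono)
      then show "mpoly_value f w \<noteq> 0" using lkc(1,2) by (auto simp: m_def zero_power)
    qed
  qed
qed

lemma power_int_root_exists:
  fixes y :: "'a::alg_closed_field"
  assumes "y \<noteq> 0" "k \<noteq> 0"
  shows "\<exists>x. x \<noteq> 0 \<and> x powi k = y"
proof -
  have pos: "nat \<bar>k\<bar> > 0" using assms by simp
  obtain x where x: "x ^ nat \<bar>k\<bar> = (if k \<ge> 0 then y else inverse y)"
    using nth_root_exists[OF pos] by blast
  then have "x \<noteq> 0" using assms pos by (auto simp: zero_power split: if_splits)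
  moreover have "x powi k = y" using x by (auto simp: power_int_def power_inverse split: if_splits)
  ultimately show ?thesis by blast
qed

theorem theorem5p4:
  fixes \<theta> :: "'k::alg_closed_field \<Rightarrow> 'k"
    and n :: nat
    and Y :: "'k list set"
    and P :: "nat \<Rightarrow> int poly"
    and \<delta> :: "nat \<Rightarrow> 'k"
  assumes "ACFH \<theta>"
    and "mult_free_constructible n n Y"
    and "\<And>i. i < n \<Longrightarrow> P i \<notin> range (\<lambda>c. [:c:])"
    and "\<And>i. i < n \<Longrightarrow> \<delta> i \<noteq> 0"
  shows "\<exists>a \<in> Y. \<forall>i<n. poly_endo \<theta> (P i) (a ! i) = \<delta> i"
proof -
  from assms(2) obtain W where Y: "constructible n Y" and W: "irreducible_component n W (zariski_closure n Y)"
    and Wfree: "mult_free n n W"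
    by (auto simp: mult_free_constructible_def)
  have Wclosed: "zariski_closed n W" using W by (simp add: irreducible_component_def affine_variety_def)
  obtain f where f: "f \<in> mpoly_ring n" "f \<notin> vanishing_ideal n W" "\<And>v. v \<in> W \<Longrightarrow> mpoly_value f v \<noteq> 0 \<Longrightarrow> v \<in> Y"
    using constructible_contains_open_of_component[OF Y W] by blast
  obtain a where gen: "generic_point n W a" and a_nz: "\<forall>i<n. a ! i \<noteq> 0"
    and a_free: "\<forall>l :: nat \<Rightarrow> int. (\<Prod>i<n. (a ! i) powi l i) \<in> univ_emb ` (- {0}) \<longrightarrow> (\<forall>i<n. l i = 0)"
    using Wfree unfolding mult_free_def by blast
  have la: "length a = n" using gen by (simp add: generic_point_def affine_space_def)
  have a: "mult_indep a" using a_nz a_free la by (auto simp: mult_indep_def in_set_conv_nth)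
  have fa: "mpoly_eval univ_emb f a \<noteq> 0"
    using gen f(1,2) by (auto simp: generic_point_def vanishing_ideal_def)
  obtain e where e: "mult_indep (a @ [e])"
    "\<And>z w. specialises z w \<Longrightarrow> n < length z \<Longrightarrow> take (Suc n) z = a @ [e] \<Longrightarrow> mpoly_value f w \<noteq> 0"
    using nonvanishing_coordinate[OF a _ fa] f(1) la by blast

  define d where "d i = degree (P i)" for i
  define D where "D = (\<Sum>i<n. d i)"
  have d_le: "d i \<le> D" if "i < n" for i
    unfolding D_def using that by (intro member_le_sum) auto
  have d_pos: "0 < d i" if "i < n" for i
    using assms(3)[OF that] unfolding d_def by (metis degree_eq_zeroE gr0I rangeI)
  \<comment> \<open>Rows have length \<open>Suc n\<close> since position \<open>n\<close> holds
    \<open>e\<close>; thus \<open>ix i 0 = i\<close> and the first row is \<open>a @ [e]\<close>. As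
    \<open>D\<close> bounds all degrees, a rectangular grid holds all iterates; the remaining
    entries are independent padding.\<close>
  define r where "r = Suc n * Suc D"
  define ix where "ix i j = i + Suc n * j" for i j
  have ix_lt: "ix i j < r" if "i < n" "j \<le> D" for i j
  proof -
    have "ix i j < Suc n + Suc n * j" using that by (simp add: ix_def)
    also have "\<dots> = Suc n * Suc j" by simp
    also have "\<dots> \<le> r" unfolding r_def using that by (intro mult_le_mono2) simp
    finally show ?thesis .
  qed
  obtain y where y: "length y = Suc n * D" "mult_indep ((a @ [e]) @ y)"
    using mult_indep_extend[OF e(1)] by blast
  define x where "x = (a @ [e]) @ y"
  have x: "mult_indep x" and lx: "length x = r" using y la by (simp_all add: x_def r_def)
  have x_nz: "x ! i \<noteq> 0" if "i < r" for i using mult_indep_nonzero[OF x] that lx by simp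

  \<comment> \<open>\<open>R i\<close> is a possible value of the top iterate: the equation is
    solved for the factor of index \<open>d i\<close>, whose exponent is the leading
    coefficient.\<close>
  have "\<exists>R. R \<noteq> 0 \<and> R powi coeff (P i) (d i) =
      univ_emb (\<delta> i) * (\<Prod>j<d i. (x ! ix i j) powi (- coeff (P i) j))" if i: "i < n" for i
  proof (rule power_int_root_exists)
    have "x ! ix i j \<noteq> 0" if "j < d i" for j using x_nz ix_lt[OF i] d_le[OF i] that by simp
    then show "univ_emb (\<delta> i) * (\<Prod>j<d i. (x ! ix i j) powi (- coeff (P i) j)) \<noteq> 0"
      using assms(4)[OF i] by (simp add: univ_emb_eq_0_iff power_int_eq_0_iff)
    show "coeff (P i) (d i) \<noteq> 0" using d_pos[OF i] by (auto simp: d_def)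
  qed
  then have "\<forall>i. \<exists>R. i < n \<longrightarrow> R \<noteq> 0 \<and> R powi coeff (P i) (d i) =
      univ_emb (\<delta> i) * (\<Prod>j<d i. (x ! ix i j) powi (- coeff (P i) j))"
    by blast
  from choice[OF this] obtain R where R: "\<And>i. i < n \<Longrightarrow> R i \<noteq> 0" "\<And>i. i < n \<Longrightarrow> R i powi coeff (P i) (d i) =
      univ_emb (\<delta> i) * (\<Prod>j<d i. (x ! ix i j) powi (- coeff (P i) j))"
    by blast
  \<comment> \<open>Position \<open>\<rho>\<close> encodes a pair \<open>(i, j)\<close>. The
    padding, including the column of \<open>e\<close>, gets 1; any nonzero value would do.\<close>
  define x'_at where "x'_at \<rho> = (let i = \<rho> mod Suc n; j = \<rho> div Suc n in
     if i < n \<and> Suc j < d i then x ! ix i (Suc j) else if i < n \<and> Suc j = d i then R i else 1)" for \<rho>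
  define x' where "x' = map x'_at [0..<r]"
  have lx': "length x' = length x" by (simp add: x'_def lx)
  have ix_div: "ix i j mod Suc n = i" "ix i j div Suc n = j" if "i < n" for i j
    using that by (simp_all add: ix_def del: mult_Suc)
  have x'_shift: "x' ! ix i j = x ! ix i (Suc j)" if "i < n" "Suc j < d i" for i j
    using that ix_lt[of i j] d_le[of i] by (simp add: x'_def x'_at_def ix_div)
  have x'_last: "x' ! ix i (d i - 1) = R i" if "i < n" for i
    using that ix_lt[of i "d i - 1"] d_le[of i] d_pos[of i] by (simp add: x'_def x'_at_def ix_div)
  have x'_nz: "0 \<notin> set x'"
  proof -
    have "x ! ix i j \<noteq> 0" if "i < n" "j < d i" for i j
      using that d_le[of i] by (intro x_nz ix_lt) simp_all
    then have "x'_at \<rho> \<noteq> 0" for \<rho>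
      using R(1) unfolding x'_at_def Let_def by simp
    then show ?thesis unfolding x'_def set_map by (metis imageE)
  qed

  obtain \<alpha> \<beta> where \<alpha>: "length \<alpha> = r" "length \<beta> = r"
    and spec: "specialises (x @ map inverse x @ x' @ map inverse x') (\<alpha> @ \<beta> @ map \<theta> \<alpha> @ map \<theta> \<beta>)"
    using ACFH_specialisation[OF assms(1) x lx' x'_nz] unfolding lx .
  define z where "z = x @ map inverse x @ x' @ map inverse x'"
  define w where "w = \<alpha> @ \<beta> @ map \<theta> \<alpha> @ map \<theta> \<beta>"
  have zw: "specialises z w" using spec by (simp add: z_def w_def)
  have lz: "length z = 4 * r" using lx lx' by (simp add: z_def)
  have z1: "z ! i = x ! i" "z ! (2 * r + i) = x' ! i" and w1: "w ! i = \<alpha> ! i" "w ! (2 * r + i) = \<theta> (\<alpha> ! i)"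
    if "i < r" for i
    using that lx lx' \<alpha> by (simp_all add: z_def w_def nth_append)
  have nr: "n < r" by (simp add: r_def)
  have za: "z ! i = a ! i" if "i < n" for i
    using that nr la by (simp add: z1 x_def nth_append)
  have tz: "take (Suc n) z = a @ [e]" using la by (simp add: z_def x_def)

  define b where "b = take n \<alpha>"
  have b: "b \<in> affine_space n" "\<And>i. i < n \<Longrightarrow> b ! i = \<alpha> ! i"
    using \<alpha> nr by (simp_all add: b_def affine_space_def)
  have val: "mpoly_value p w = mpoly_value p b" if "p \<in> mpoly_ring n" for p
    using that b(2) w1(1) nr by (intro mpoly_eval_cong) auto
  \<comment> \<open>The vanishing ideal of \<open>W\<close> consists of relations of
    \<open>a\<close>, which are relations of the first \<open>n\<close> coordinates of
    \<open>z\<close> and so hold at \<open>b\<close>.\<close>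
  have "b \<in> W"
  proof -
    have "mpoly_value p b = 0" if p: "p \<in> vanishing_ideal n W" for p
    proof -
      have pn: "p \<in> mpoly_ring n" using p by (simp add: vanishing_ideal_def)
      have "mpoly_eval univ_emb p a = 0" using gen p by (auto simp: generic_point_def vanishing_ideal_def)
      then have "mpoly_eval univ_emb p z = 0" using za mpoly_eval_cong[OF pn, of z a] by simp
      moreover have "p \<in> mpoly_ring (length z)" using mpoly_ring_mono[OF pn] nr lz by simp
      ultimately show ?thesis using zw val[OF pn] by (simp add: specialises_def)
    qed
    then have "b \<in> zero_set n (vanishing_ideal n W)" using b(1) by (simp add: zero_set_def)
    then show ?thesis using Wclosed zariski_closed_iff by blast
  qed
  moreover have "mpoly_value f b \<noteq> 0" using e(2)[OF zw _ tz] lz nr val[OF f(1)] by simp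
  ultimately have "b \<in> Y" using f(3) by blast

  have \<theta>: "\<And>u v. \<theta> (u * v) = \<theta> u * \<theta> v" "\<theta> 1 = 1" "\<theta> 0 = 0"
    using assms(1) by (auto simp: ACFH_def multiplicative_map_def)
  have \<theta>j: "(\<theta> ^^ j) (u powi k) = (\<theta> ^^ j) u powi k" for j u k
  proof (induction j)
    case (Suc j)
    then show ?case using multiplicative_power_int[of \<theta>] \<theta> by simp
  qed simp
  \<comment> \<open>Used as \<open>f\<close> with exponent 0, it turns
    \<open>specialises_laurent\<close> into a statement about pure Laurent monomials.\<close>
  have one: "(1 :: 'k mpoly) \<in> mpoly_ring (length z)" by (rule subring_setD(2)[OF subring_set_mpoly_ring])
  have "poly_endo \<theta> (P i) (b ! i) = \<delta> i" if i: "i < n" for i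
  proof -
    have ixr: "ix i j < r" if "j \<le> d i" for j using ix_lt[OF i] d_le[OF i] that by simp
    \<comment> \<open>By \<open>x'_shift\<close> two coordinates of \<open>z\<close> agree; the
      equality passes to \<open>w\<close>, whose third block consists of true images under
      \<open>\<theta>\<close>.\<close>
    have step: "\<alpha> ! ix i (Suc j) = \<theta> (\<alpha> ! ix i j)" if j: "Suc j < d i" for j
    proof -
      let ?p = "mpoly_var (2 * r + ix i j) - mpoly_var (ix i (Suc j))"
      have lt: "ix i j < r" "ix i (Suc j) < r" using ixr j by auto
      have ev: "mpoly_eval h ?p v = v ! (2 * r + ix i j) - v ! ix i (Suc j)" if "hom_on UNIV h"
        for h :: "'k \<Rightarrow> 'l::comm_ring_1" and v
        using that by (simp add: mpoly_eval_diff mpoly_eval_var)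
      have "?p \<in> mpoly_ring (length z)"
        using lt lz by (intro mpoly_ring_diff mpoly_ring_var) auto
      moreover have "mpoly_eval univ_emb ?p z = 0"
        using x'_shift[OF i j] lt by (simp add: ev[OF hom_on_univ_emb] z1)
      ultimately have "mpoly_value ?p w = 0" using zw by (auto simp: specialises_def)
      then show ?thesis using lt by (simp add: ev[OF hom_on_id] w1)
    qed
    have iter: "\<alpha> ! ix i j = (\<theta> ^^ j) (b ! i)" if "j < d i" for j
      using that
    proof (induction j)
      case 0
      then show ?case using b(2)[OF i] by (simp add: ix_def)
    next
      case (Suc j)
      then show ?case using step[of j] by simp
    qed
    \<comment> \<open>The top iterate has no coordinate in the \<open>x\<close> block; it is the
      \<open>x'\<close> partner of the last one, found past \<open>x\<close> and its inverses at
      offset \<open>2 * r\<close>.\<close>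
    define \<sigma> where "\<sigma> j = (if j < d i then ix i j else 2 * r + ix i (d i - 1))" for j
    have \<sigma>_lt: "\<sigma> j < length z" for j
      using ixr[of j] ixr[of "d i - 1"] lz by (auto simp: \<sigma>_def)
    have split: "{..d i} = insert (d i) {..<d i}" by auto
    have zprod: "(\<Prod>j\<le>d i. (z ! \<sigma> j) powi coeff (P i) j) = univ_emb (\<delta> i)"
    proof -
      have "(\<Prod>j<d i. (z ! \<sigma> j) powi coeff (P i) j) = (\<Prod>j<d i. (x ! ix i j) powi coeff (P i) j)"
        using ixr by (intro prod.cong) (auto simp: \<sigma>_def z1)
      moreover have "z ! \<sigma> (d i) = R i"
        using ixr[of "d i - 1"] x'_last[OF i] by (simp add: \<sigma>_def z1)
      moreover have "(\<Prod>j<d i. (x ! ix i j) powi (- coeff (P i) j)) * (\<Prod>j<d i. (x ! ix i j) powi coeff (P i) j) = 1"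
        using ixr x_nz by (simp add: power_int_minus flip: prod.distrib)
      ultimately show ?thesis
        by (simp add: split R(2)[OF i] mult.assoc)
    qed
    have wprod: "(\<Prod>j\<le>d i. (w ! \<sigma> j) powi coeff (P i) j) = \<delta> i"
      using specialises_laurent[OF zw one, of "{..d i}" \<sigma> 0 "coeff (P i)" "\<delta> i"] \<sigma>_lt zprod by simp
    have "w ! \<sigma> j = (\<theta> ^^ j) (b ! i)" if "j \<le> d i" for j
    proof (cases "j < d i")
      case True
      then show ?thesis using ixr[of j] iter by (simp add: \<sigma>_def w1)
    next
      case False
      then have "j = Suc (d i - 1)" using that d_pos[OF i] by simp
      then show ?thesis
        using False ixr[of "d i - 1"] iter[of "d i - 1"] d_pos[OF i]
        by (metis \<sigma>_def comp_apply diff_le_self diff_less funpow.simps(2) w1(2) zero_less_one)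
    qed
    then show ?thesis
      using wprod by (simp add: poly_endo_def \<theta>j flip: d_def)
  qed
  with \<open>b \<in> Y\<close> show ?thesis by blast
qed

end
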